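(* Let $n\ge 1$ and let $K_0,K_1,\dots,K_n$ be strictly concave kernel functions such that either all of them satisfy condition $(\infty')$, or all of them belong to $\mathrm{C}^1(0,2\pi)$. For $\mathbf{y}=(y_1,\dots,y_n)\in\mathbb{T}^n$ let $F(\mathbf{y},t)=K_0(t)+\sum_{j=1}^nK_j(t-y_j)$. Then there is $\mathbf{w}^*=(w_1,\dots,w_n)\in\mathbb{T}^n$ with \[M:=\inf_{\mathbf{y}\in\mathbb{T}^n}\sup_{t\in\mathbb{T}}F(\mathbf{y},t)=\sup_{t\in\mathbb{T}}F(\mathbf{w}^*,t).\] Moreover: (a) $\mathbf{w}^*$ is an equioscillation point, i.e. $m_0(\mathbf{w}^* )=\dots=m_n(\mathbf{w}^* )$; (b) $\mathbf{w}^*\in S:=S_\sigma$ for some permutation $\sigma$ (so the nodes $0,w_1,\dots,w_n$ are pairwise different), and \[M(S)=\inf_{\mathbf{y}\in S}\max_{j=0,\dots,n}\sup_{t\in I_j(\mathbf{y})}F(\mathbf{y},t)=M=\sup_{\mathbf{y}\in S}\min_{j=0,\dots,n}\sup_{t\in I_j(\mathbf{y})}F(\mathbf{y},t)=m(S);\] (c) the Sandwich Property holds on $S$: for all $\mathbf{x},\mathbf{y}\in S$, $\underline{m}(\mathbf{x})\le M\le\overline{m}(\mathbf{y})$.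
   Context: Identify the torus $\mathbb{T}=\mathbb{R}/2\pi\mathbb{Z}$ with $[0,2\pi)$. A concave kernel function is a $2\pi$-periodic function $K:\mathbb{R}\to[-\infty,\infty)$ which is real-valued and concave on $(0,2\pi)$ and such that $\lim_{t\downarrow0}K(t)$ and $\lim_{t\uparrow2\pi}K(t)$ exist in $[-\infty,\infty)$ and are equal (their common value being $K(0)=K(2\pi)$); it is strictly concave if it is strictly concave on $(0,2\pi)$. $D_\pm$ denote one-sided derivatives. Condition $(\infty')$ for $K$: either $\lim_{t\uparrow2\pi}D_-K(t)=\lim_{t\uparrow2\pi}D_+K(t)=-\infty$, or $\lim_{t\downarrow0}D_-K(t)=\lim_{t\downarrow0}D_+K(t)=+\infty$. For a node system $\mathbf{y}\in\mathbb{T}^n$ put $y_0=0$, $y_{n+1}=2\pi$. For a permutation $\sigma$ of $\{1,\dots,n\}$ set $\sigma(0)=0,\sigma(n+1)=n+1$ and define the simplex $S_\sigma=\{\mathbf{y}\in\mathbb{T}^n:0<y_{\sigma(1)}<\dots<y_{\sigma(n)}<2\pi\}$; its closure consists of the $\mathbf{y}$ with $0\le y_{\sigma(1)}\le\dots\le y_{\sigma(n)}\le2\pi$. For $\mathbf{y}\in\overline{S_\sigma}$ and $k=0,\dots,n$, $I_{\sigma(k)}(\mathbf{y})=[y_{\sigma(k)},y_{\sigma(k+1)}]$ and $m_{\sigma(k)}(\mathbf{y})=\sup_{t\in I_{\sigma(k)}(\mathbf{y})}F(\mathbf{y},t)$ (the permutation being fixed). $\overline{m}(\mathbf{y})=\max_jm_j(\mathbf{y})=\sup_{t\in\mathbb{T}}F(\mathbf{y},t)$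 and $\underline{m}(\mathbf{y})=\min_jm_j(\mathbf{y})$. For $A\subseteq\mathbb{T}^n$, $M(A)=\inf_{\mathbf{y}\in A}\overline{m}(\mathbf{y})$ and $m(A)=\sup_{\mathbf{y}\in A}\underline{m}(\mathbf{y})$. A point $\mathbf{y}$ (of the closure of a fixed simplex) is an equioscillation point if $m_0(\mathbf{y})=\dots=m_n(\mathbf{y})$. *)

theory Defs
  imports "HOL-Analysis.Analysis" "HOL-Combinatorics.Permutations" "HOL-Library.FuncSet"
begin

definition strictly_concave_on :: "real set \<Rightarrow> (real \<Rightarrow> real) \<Rightarrow> bool" where
  "strictly_concave_on S f \<longleftrightarrow> convex S \<and>
     (\<forall>x\<in>S. \<forall>y\<in>S. x \<noteq> y \<longrightarrow> (\<forall>u::real. 0 < u \<and> u < 1 \<longrightarrow>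
        f (u * x + (1 - u) * y) > u * f x + (1 - u) * f y))"

text \<open>Kernels take values in [-infinity, infinity), modelled as ereal with no +infinity value.
  Real-valued on (0,2pi), 2pi-periodic, one-sided limits at 0 and 2pi exist and equal K 0.\<close>
definition kernel_base :: "(real \<Rightarrow> ereal) \<Rightarrow> bool" where
  "kernel_base K \<longleftrightarrow>
     (\<forall>t. K (t + 2*pi) = K t) \<and>
     (\<forall>t. K t \<noteq> \<infinity>) \<and>
     (\<forall>t\<in>{0<..<2*pi}. K t \<noteq> -\<infinity>) \<and>
     (K \<longlongrightarrow> K 0) (at_right 0) \<and>
     (K \<longlongrightarrow> K 0) (at_left (2*pi))"

definition concave_kernel :: "(real \<Rightarrow> ereal) \<Rightarrow> bool" where
  "concave_kernel K \<longleftrightarrow> kernel_base K \<and>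
     concave_on {0<..<2*pi} (\<lambda>t. real_of_ereal (K t))"

definition strictly_concave_kernel :: "(real \<Rightarrow> ereal) \<Rightarrow> bool" where
  "strictly_concave_kernel K \<longleftrightarrow> concave_kernel K \<and>
     strictly_concave_on {0<..<2*pi} (\<lambda>t. real_of_ereal (K t))"

text \<open>One-sided derivatives (they exist in the interior for concave functions).\<close>
definition Dplus :: "(real \<Rightarrow> real) \<Rightarrow> real \<Rightarrow> real" where
  "Dplus f t = Lim (at_right 0) (\<lambda>h. (f (t + h) - f t) / h)"

definition Dminus :: "(real \<Rightarrow> real) \<Rightarrow> real \<Rightarrow> real" where
  "Dminus f t = Lim (at_left 0) (\<lambda>h. (f (t + h) - f t) / h)"

definition cond_infty' :: "(real \<Rightarrow> ereal) \<Rightarrow> bool" where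
  "cond_infty' K \<longleftrightarrow>
     (let k = (\<lambda>t. real_of_ereal (K t)) in
       (filterlim (Dminus k) at_bot (at_left (2*pi)) \<and>
        filterlim (Dplus k) at_bot (at_left (2*pi)))
     \<or> (filterlim (Dminus k) at_top (at_right 0) \<and>
        filterlim (Dplus k) at_top (at_right 0)))"

definition C1_kernel :: "(real \<Rightarrow> ereal) \<Rightarrow> bool" where
  "C1_kernel K \<longleftrightarrow> (\<exists>K'. (\<forall>t\<in>{0<..<2*pi}.
        ((\<lambda>s. real_of_ereal (K s)) has_real_derivative K' t) (at t))
      \<and> continuous_on {0<..<2*pi} K')"

text \<open>Node systems y in T^n, T identified with [0,2pi); components y 1, ..., y n.\<close>
definition nodes :: "nat \<Rightarrow> (nat \<Rightarrow> real) set" where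
  "nodes n = ({1..n} \<rightarrow>\<^sub>E {0..<2*pi})"

definition ynode :: "nat \<Rightarrow> (nat \<Rightarrow> real) \<Rightarrow> nat \<Rightarrow> real" where
  "ynode n y k = (if k = 0 then 0 else if k = n + 1 then 2*pi else y k)"

definition Fsum :: "nat \<Rightarrow> (nat \<Rightarrow> real \<Rightarrow> ereal) \<Rightarrow> (nat \<Rightarrow> real) \<Rightarrow> real \<Rightarrow> ereal" where
  "Fsum n K y t = K 0 t + (\<Sum>j\<in>{1..n}. K j (t - y j))"

text \<open>Open simplex S_sigma (sigma permutes {1..n}, hence fixes 0 and n+1).\<close>
definition Ssimplex :: "nat \<Rightarrow> (nat \<Rightarrow> nat) \<Rightarrow> (nat \<Rightarrow> real) set" where
  "Ssimplex n \<sigma> = {y \<in> nodes n. \<forall>k\<in>{0..n}. ynode n y (\<sigma> k) < ynode n y (\<sigma> (k + 1))}"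

text \<open>m_{sigma(k)}(y) = sup of F over I_{sigma(k)}(y) = [y_sigma(k), y_sigma(k+1)].\<close>
definition mloc :: "nat \<Rightarrow> (nat \<Rightarrow> real \<Rightarrow> ereal) \<Rightarrow> (nat \<Rightarrow> nat) \<Rightarrow> (nat \<Rightarrow> real) \<Rightarrow> nat \<Rightarrow> ereal" where
  "mloc n K \<sigma> y k = (SUP t\<in>{ynode n y (\<sigma> k)..ynode n y (\<sigma> (k + 1))}. Fsum n K y t)"

definition mbar :: "nat \<Rightarrow> (nat \<Rightarrow> real \<Rightarrow> ereal) \<Rightarrow> (nat \<Rightarrow> nat) \<Rightarrow> (nat \<Rightarrow> real) \<Rightarrow> ereal" where
  "mbar n K \<sigma> y = Max ((mloc n K \<sigma> y) ` {0..n})"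

definition munder :: "nat \<Rightarrow> (nat \<Rightarrow> real \<Rightarrow> ereal) \<Rightarrow> (nat \<Rightarrow> nat) \<Rightarrow> (nat \<Rightarrow> real) \<Rightarrow> ereal" where
  "munder n K \<sigma> y = Min ((mloc n K \<sigma> y) ` {0..n})"

definition equioscillation :: "nat \<Rightarrow> (nat \<Rightarrow> real \<Rightarrow> ereal) \<Rightarrow> (nat \<Rightarrow> nat) \<Rightarrow> (nat \<Rightarrow> real) \<Rightarrow> bool" where
  "equioscillation n K \<sigma> y \<longleftrightarrow> (\<forall>k\<in>{0..n}. mloc n K \<sigma> y k = mloc n K \<sigma> y 0)"

end

theory Submission
  imports Defs
begin

text \<open>
  Let \<open>w\<close> minimize the maximum of \<open>F(y, \<cdot>)\<close> over all node systems \<open>y\<close>. No maximum point of \<open>F(w, \<cdot>)\<close>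
  is a node: there \<open>(\<infinity>')\<close> gives an infinite one-sided slope, and \<open>C\<^sup>1\<close> summands cannot compensate the
  convex kink of a kernel. While \<open>t\<close> stays in one arc, \<open>(y, t) \<mapsto> F(y, t)\<close> is jointly concave, and
  strictly concave in \<open>t\<close>, so each open arc between consecutive nodes contains at most one maximum
  point. If some arc contained none, there would be at most \<open>n\<close> maximum points; their supergradients
  would admit a common non-increasing direction \<open>v \<noteq> 0\<close> in \<open>\<real>\<^sup>n\<close>, and moving the nodes along \<open>v\<close>
  would strictly lower the maximum. Hence every arc contains a maximum point: the nodes are distinct
  and \<open>w\<close> equioscillates. If all \<open>m\<^sub>k(x)\<close> exceeded the minimum for some \<open>x\<close> in the same simplex,
  then, each \<open>m\<^sub>k\<close> being concave, all of them would be below it at \<open>w + s(w - x)\<close> for small \<open>s > 0\<close>,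
  contradicting minimality.
\<close>

section \<open>Concave functions of a real variable\<close>

lemma strictly_concave_on_imp_concave_on:
  assumes "strictly_concave_on S f"
  shows "concave_on S f"
proof
  fix t x y :: real
  assume "0 < t" "t < 1" "x \<in> S" "y \<in> S" "x < y"
  moreover from this have "x \<noteq> y" "0 < 1 - t" "1 - t < 1" by simp_all
  ultimately have "(1 - t) * f x + (1 - (1 - t)) * f y < f ((1 - t) * x + (1 - (1 - t)) * y)"
    using assms unfolding strictly_concave_on_def by blast
  then show "(1 - t) * f x + t * f y \<le> f ((1 - t) *\<^sub>R x + t *\<^sub>R y)" by simp
qed (use assms in \<open>simp add: strictly_concave_on_def\<close>)

lemma strictly_concave_on_midpoint:
  assumes "strictly_concave_on S f" "x \<in> S" "y \<in> S" "x \<noteq> y"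
  shows "(f x + f y) / 2 < f ((x + y) / 2)"
proof -
  have "u * f x + (1 - u) * f y < f (u * x + (1 - u) * y)" if "0 < u" "u < 1" for u
    using assms that unfolding strictly_concave_on_def by blast
  from this[of "1 / 2"] have "1 / 2 * f x + (1 - 1 / 2) * f y < f (1 / 2 * x + (1 - 1 / 2) * y)"
    by simp
  then show ?thesis by (simp add: field_simps)
qed

lemma affine_map_combination:
  fixes m c u v x y :: real
  assumes "u + v = 1"
  shows "m * (u * x + v * y) + c = u * (m * x + c) + v * (m * y + c)"
proof -
  have "u * c + v * c = c" using assms by (simp flip: distrib_right)
  then show ?thesis by (simp add: algebra_simps)
qed

lemma convex_vimage_affine:
  fixes m c :: real
  assumes "convex S"
  shows "convex ((\<lambda>t. m * t + c) -` S)"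
  using assms by (auto simp: convex_def affine_map_combination)

lemma concave_on_compose_affine:
  fixes m c :: real
  assumes "concave_on S f"
  shows "concave_on ((\<lambda>t. m * t + c) -` S) (\<lambda>t. f (m * t + c))"
  using assms by (simp add: concave_on_iff convex_vimage_affine affine_map_combination)

lemma strictly_concave_on_compose_affine:
  assumes "strictly_concave_on S f" "m \<noteq> 0"
  shows "strictly_concave_on ((\<lambda>t. m * t + c) -` S) (\<lambda>t. f (m * t + c))"
  using assms by (simp add: strictly_concave_on_def convex_vimage_affine affine_map_combination)

lemma concave_on_closure:
  fixes f :: "'a::real_normed_vector \<Rightarrow> real"
  assumes f: "concave_on S f" and cont: "continuous_on (closure S) f"
  shows "concave_on (closure S) f"
  unfolding concave_on_iff
proof (intro conjI ballI allI impI)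
  have "convex S" using f by (rule concave_on_imp_convex)
  then show convex: "convex (closure S)" by (rule convex_closure)
  fix x y u v
  assume xy: "x \<in> closure S" "y \<in> closure S" and uv: "0 \<le> u" "0 \<le> v" "u + v = (1::real)"
  define gap where "gap p = f (u *\<^sub>R fst p + v *\<^sub>R snd p) - (u * f (fst p) + v * f (snd p))" for p
  have "continuous_on (closure (S \<times> S)) gap"
    unfolding gap_def closure_Times
    by (intro continuous_intros continuous_on_compose2[OF cont])
      (auto simp: image_subset_iff intro!: convexD[OF convex _ _ uv])
  moreover have "0 \<le> gap p" if "p \<in> S \<times> S" for p
  proof -
    have "fst p \<in> S" "snd p \<in> S" using that by auto
    then show ?thesis using f uv unfolding concave_on_iff gap_def by (metis diff_ge_0_iff_ge)
  qed
  moreover have "(x, y) \<in> closure (S \<times> S)" using xy by (simp add: closure_Times)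
  ultimately have "0 \<le> gap (x, y)" using continuous_ge_on_closure by blast
  then show "u * f x + v * f y \<le> f (u *\<^sub>R x + v *\<^sub>R y)" by (simp add: gap_def)
qed

lemma concave_on_slope_le:
  fixes f :: "real \<Rightarrow> real"
  assumes "concave_on S f" "x \<in> S" "z \<in> S" "x < y" "y < z"
  shows "(f z - f x) / (z - x) \<le> (f y - f x) / (y - x)"
    and "(f z - f y) / (z - y) \<le> (f z - f x) / (z - x)"
proof -
  have slope_of_negatives: "(- p - - q) / (a - b) = - ((q - p) / (b - a))" for p q a b :: real
    by (metis minus_diff_eq minus_diff_minus minus_divide_divide minus_divide_left)
  show "(f z - f x) / (z - x) \<le> (f y - f x) / (y - x)"
    "(f z - f y) / (z - y) \<le> (f z - f x) / (z - x)"
    using convex_on_slope_le[of S "\<lambda>t. - f t" x z y] assms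
    unfolding slope_of_negatives by (auto simp: concave_on_def)
qed

section \<open>One-sided derivatives\<close>

lemma Dplus_tendsto:
  assumes f: "concave_on S f" and t: "t \<in> interior S"
  shows "((\<lambda>h. (f (t + h) - f t) / h) \<longlongrightarrow> Dplus f t) (at_right 0)"
proof -
  define q where "q h = - ((f (t + h) - f t) / h)" for h
  obtain e where e: "0 < e" "cball t e \<subseteq> S" using t by (auto simp: mem_interior_cball)
  then have S: "t + h \<in> S" if "\<bar>h\<bar> \<le> e" for h using that by (auto simp: dist_norm)
  note slopes = concave_on_slope_le[OF f]
  have mono: "q h \<le> q h'" if "h' \<in> {..<e}" "0 < h" "h \<le> h'" for h h'
  proof (cases "h = h'")
    case False
    then show ?thesis
      using slopes(1)[of t "t + h'" "t + h"] S[of 0] S[of h'] that e by (simp add: q_def)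
  qed simp
  define s where "s = t + - e"
  have s: "s \<in> S" "s < t" using S[of "- e"] e by (auto simp: s_def)
  have bound: "- ((f t - f s) / (t - s)) \<le> q h" if "h \<in> {..<e}" "0 < h" for h
    using slopes[of s "t + h" t] S[of h] s that by (simp add: q_def)
  have "(q \<longlongrightarrow> Inf (q ` ({0<..} \<inter> {..<e}))) (at 0 within ({0<..} \<inter> {..<e}))"
    by (rule Lim_right_bound) (use mono bound in auto)
  moreover have "at 0 within ({0<..} \<inter> {..<e}) = at_right 0"
    by (rule at_within_nhd[of _ "{..<e}"]) (use e in auto)
  ultimately obtain l where "(q \<longlongrightarrow> l) (at_right 0)" by metis
  then have "((\<lambda>h. (f (t + h) - f t) / h) \<longlongrightarrow> - l) (at_right 0)"
    using tendsto_minus[of q l "at_right 0"] by (simp add: q_def)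
  moreover from this have "Dplus f t = - l"
    unfolding Dplus_def by (intro tendsto_Lim) auto
  ultimately show ?thesis by simp
qed

lemma Dplus_ge_slope:
  assumes f: "concave_on S f" and t: "t \<in> interior S" and s: "s \<in> S" "t < s"
  shows "(f s - f t) / (s - t) \<le> Dplus f t"
proof (rule tendsto_lowerbound[OF Dplus_tendsto[OF f t]])
  have "\<forall>\<^sub>F h in at_right 0. h \<in> {0<..<s - t}"
    using s by (intro eventually_at_right_real) auto
  then show "\<forall>\<^sub>F h in at_right 0. (f s - f t) / (s - t) \<le> (f (t + h) - f t) / h"
  proof eventually_elim
    case (elim h)
    then show ?case
      using concave_on_slope_le(1)[OF f, of t s "t + h"] s t interior_subset[of S] by auto
  qed
qed simp

lemma Dplus_le_slope:
  assumes f: "concave_on S f" and t: "t \<in> interior S" and s: "s \<in> S" "s < t"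
  shows "Dplus f t \<le> (f t - f s) / (t - s)"
proof (rule tendsto_upperbound[OF Dplus_tendsto[OF f t]])
  obtain e where e: "0 < e" "cball t e \<subseteq> S" using t by (auto simp: mem_interior_cball)
  then have S: "t + h \<in> S" if "\<bar>h\<bar> \<le> e" for h using that by (auto simp: dist_norm)
  have "\<forall>\<^sub>F h in at_right 0. h \<in> {0<..<e}"
    using e by (intro eventually_at_right_real) auto
  then show "\<forall>\<^sub>F h in at_right 0. (f (t + h) - f t) / h \<le> (f t - f s) / (t - s)"
  proof eventually_elim
    case (elim h)
    then show ?case using concave_on_slope_le[OF f, of s "t + h" t] S[of h] s by auto
  qed
qed simp

lemma concave_on_reflect:
  fixes f :: "real \<Rightarrow> real"
  assumes "concave_on S f"
  shows "concave_on (uminus ` S) (\<lambda>t. f (- t))"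
  using concave_on_compose_affine[OF assms, of "-1" 0] by (simp add: minus_image_eq_vimage)

lemma Dminus_eq_Dplus_reflect:
  assumes f: "concave_on S f" and t: "t \<in> interior S"
  shows "Dminus f t = - Dplus (\<lambda>s. f (- s)) (- t)"
proof -
  have "- t \<in> interior (uminus ` S)" using t by (simp add: interior_negations)
  from Dplus_tendsto[OF concave_on_reflect[OF f] this]
  have "((\<lambda>h. - ((f (t - h) - f t) / h)) \<longlongrightarrow> - Dplus (\<lambda>s. f (- s)) (- t)) (at_right 0)"
    by (intro tendsto_minus) simp
  then have "((\<lambda>h. (f (t + h) - f t) / h) \<longlongrightarrow> - Dplus (\<lambda>s. f (- s)) (- t)) (at_left 0)"
    by (simp add: filterlim_at_left_to_right flip: minus_divide_left)
  then show ?thesis unfolding Dminus_def by (intro tendsto_Lim) auto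
qed

lemma Dminus_le_slope:
  assumes f: "concave_on S f" and t: "t \<in> interior S" and s: "s \<in> S" "s < t"
  shows "Dminus f t \<le> (f t - f s) / (t - s)"
proof -
  have "(f s - f t) / (- s - (- t)) \<le> Dplus (\<lambda>s. f (- s)) (- t)"
    using Dplus_ge_slope[OF concave_on_reflect[OF f], of "- t" "- s"] s t
    by (simp add: interior_negations)
  then show ?thesis
    by (simp add: Dminus_eq_Dplus_reflect[OF f t] diff_divide_distrib)
qed

lemma Dplus_le_Dminus:
  assumes f: "concave_on S f" and t: "t \<in> interior S"
  shows "Dplus f t \<le> Dminus f t"
proof -
  have "- t \<in> interior (uminus ` S)" using t by (simp add: interior_negations)
  from Dplus_tendsto[OF concave_on_reflect[OF f] this]
  have left_quotient: "((\<lambda>h. (f (t - h) - f t) / h) \<longlongrightarrow> - Dminus f t) (at_right 0)"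
    by (simp add: Dminus_eq_Dplus_reflect[OF f t])
  obtain e where e: "0 < e" "cball t e \<subseteq> S" using t by (auto simp: mem_interior_cball)
  have "\<forall>\<^sub>F h in at_right 0. h \<in> {0<..<e}" using e by (intro eventually_at_right_real) auto
  then have "\<forall>\<^sub>F h in at_right 0. (f (t - h) - f t) / h \<le> - Dplus f t"
  proof eventually_elim
    case (elim h)
    then have "t - h \<in> S" using e by (auto simp: subset_iff dist_norm)
    then show ?case using Dplus_le_slope[OF f t, of "t - h"] elim by (simp add: diff_divide_distrib)
  qed
  from tendsto_upperbound[OF left_quotient this] show ?thesis by simp
qed

lemma strictly_concave_on_less_tangent:
  assumes f: "strictly_concave_on S f" and x: "x \<in> interior S" "x' \<in> S" "x' \<noteq> x"
    and s: "Dplus f x \<le> s" "s \<le> Dminus f x"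
  shows "f x' < f x + s * (x' - x)"
proof -
  note concave = strictly_concave_on_imp_concave_on[OF f]
  have tangent: "f z \<le> f x + s * (z - x)" if "z \<in> S" for z
  proof (cases z x rule: linorder_cases)
    case less
    then have "s \<le> (f x - f z) / (x - z)"
      using Dminus_le_slope[OF concave x(1) that] s by linarith
    then show ?thesis using less by (simp add: field_simps)
  next
    case greater
    then have "(f z - f x) / (z - x) \<le> s"
      using Dplus_ge_slope[OF concave x(1) that] s by linarith
    then show ?thesis using greater by (simp add: field_simps)
  qed simp
  have "x \<in> S" using x(1) interior_subset by blast
  then have "(x' + x) / 2 \<in> S"
    using convexD[OF concave_on_imp_convex[OF concave] x(2), of x "1/2" "1/2"]
    by (simp add: field_simps)
  moreover have "(f x' + f x) / 2 < f ((x' + x) / 2)"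
    using f x \<open>x \<in> S\<close> by (intro strictly_concave_on_midpoint)
  ultimately have "(f x' + f x) / 2 < f x + s * ((x' + x) / 2 - x)"
    using tangent by fastforce
  then show ?thesis by (simp add: field_simps)
qed

definition lower_right_slope :: "(real \<Rightarrow> real) \<Rightarrow> real \<Rightarrow> real \<Rightarrow> bool" where
  "lower_right_slope f x s \<longleftrightarrow> (\<forall>\<^sub>F h in at_right 0. s * h \<le> f (x + h) - f x)"

text \<open>Slopes to the left are measured outwards: \<open>s * h \<le> f (x - h) - f x\<close> for small \<open>h > 0\<close>.\<close>
abbreviation lower_left_slope :: "(real \<Rightarrow> real) \<Rightarrow> real \<Rightarrow> real \<Rightarrow> bool" where
  "lower_left_slope f x s \<equiv> lower_right_slope (\<lambda>t. f (- t)) (- x) s"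

lemma lower_right_slope_less_limit:
  assumes "((\<lambda>h. (f (x + h) - f x) / h) \<longlongrightarrow> D) (at_right 0)" "s < D"
  shows "lower_right_slope f x s"
  unfolding lower_right_slope_def
  using order_tendstoD(1)[OF assms] eventually_at_right_less
  by eventually_elim (simp add: pos_less_divide_eq)

lemma lower_right_slope_less_Dplus:
  assumes "concave_on S f" "x \<in> interior S" "s < Dplus f x"
  shows "lower_right_slope f x s"
  using Dplus_tendsto[OF assms(1,2)] assms(3) by (rule lower_right_slope_less_limit)

lemma lower_right_slope_less_deriv:
  assumes "(f has_real_derivative D) (at x)" "s < D"
  shows "lower_right_slope f x s"
  using assms by (intro lower_right_slope_less_limit) (auto simp: DERIV_def filterlim_at_split)

lemma sum_lower_right_slopes_nonpos:
  assumes "finite A" "\<And>j. j \<in> A \<Longrightarrow> lower_right_slope (f j) (x j) (s j)"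
    and decrease: "\<forall>\<^sub>F h in at_right 0. (\<Sum>j\<in>A. f j (x j + h)) \<le> (\<Sum>j\<in>A. f j (x j))"
  shows "sum s A \<le> 0"
proof -
  have "\<forall>\<^sub>F h in at_right 0. \<forall>j\<in>A. s j * h \<le> f j (x j + h) - f j (x j)"
    using assms by (intro eventually_ball_finite) (auto simp: lower_right_slope_def)
  moreover have "\<forall>\<^sub>F h in at_right (0::real). 0 < h" by (rule eventually_at_right_less)
  ultimately have "\<forall>\<^sub>F h in at_right (0::real). sum s A \<le> 0"
    using decrease
  proof eventually_elim
    case (elim h)
    then have "sum s A * h \<le> (\<Sum>j\<in>A. f j (x j + h) - f j (x j))"
      unfolding sum_distrib_right by (intro sum_mono) auto
    also have "\<dots> \<le> 0" using elim by (simp add: sum_subtractf)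
    finally show ?case using elim by (simp add: mult_le_0_iff)
  qed
  then show ?thesis by simp
qed

section \<open>Finite systems of linear conditions\<close>

lemma exists_sum_eq_between:
  fixes l u :: "'i \<Rightarrow> real"
  assumes bounds: "\<And>i. i \<in> A \<Longrightarrow> l i \<le> u i" and "sum l A \<le> c" "c \<le> sum u A"
  shows "\<exists>a. (\<forall>i\<in>A. l i \<le> a i \<and> a i \<le> u i) \<and> sum a A = c"
proof -
  define a where "a \<theta> i = l i + \<theta> * (u i - l i)" for \<theta> i
  have "\<exists>\<theta>. 0 \<le> \<theta> \<and> \<theta> \<le> 1 \<and> sum (a \<theta>) A = c"
    using assms by (intro IVT'[of "\<lambda>\<theta>. sum (a \<theta>) A"] continuous_on_sum)
      (auto simp: a_def intro!: continuous_intros)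
  then obtain \<theta> where \<theta>: "0 \<le> \<theta>" "\<theta> \<le> 1" "sum (a \<theta>) A = c" by blast
  have "l i \<le> a \<theta> i \<and> a \<theta> i \<le> u i" if "i \<in> A" for i
    using bounds[OF that] \<theta> mult_left_le_one_le[of "u i - l i" \<theta>] by (simp add: a_def)
  then show ?thesis using \<theta>(3) by blast
qed

lemma sum_le_of_less:
  fixes r :: "'i \<Rightarrow> real"
  assumes "\<And>s. (\<And>i. i \<in> A \<Longrightarrow> s i < r i) \<Longrightarrow> sum s A \<le> c"
  shows "sum r A \<le> c"
proof (rule field_le_epsilon)
  fix e :: real assume "0 < e"
  define d where "d = e / (card A + 1)"
  have "0 < d" "card A * d \<le> e" using \<open>0 < e\<close> by (auto simp: d_def field_simps)
  then have "(\<Sum>i\<in>A. r i - d) \<le> c" by (intro assms) simp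
  then show "sum r A \<le> c + e" using \<open>card A * d \<le> e\<close> by (simp add: sum_subtractf)
qed

lemma sum_eliminate_pivot:
  fixes b c v :: "'k \<Rightarrow> 'a::field"
  assumes "finite J" "p \<notin> J"
  shows "(\<Sum>k\<in>insert p J. b k * (v(p := - (\<Sum>k\<in>J. c k * v k) / c p)) k)
    = (\<Sum>k\<in>J. (b k - b p / c p * c k) * v k)"
proof -
  have "(\<Sum>k\<in>J. b k * (v(p := x)) k) = (\<Sum>k\<in>J. b k * v k)" for x
    using assms(2) by (intro sum.cong) auto
  then show ?thesis
    using assms
    by (simp add: left_diff_distrib sum_subtractf sum_distrib_left sum_divide_distrib mult.assoc)
qed

lemma underdetermined_homogeneous_solution:
  fixes a :: "'z \<Rightarrow> 'k \<Rightarrow> 'a::field"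
  assumes "finite Z" "finite I" "card Z < card I"
  shows "\<exists>v. (\<exists>k\<in>I. v k \<noteq> 0) \<and> (\<forall>z\<in>Z. (\<Sum>k\<in>I. a z k * v k) = 0)"
  using assms
proof (induction Z arbitrary: a I rule: finite_induct)
  case empty
  then have "I \<noteq> {}" by auto
  then show ?case by (intro exI[of _ "\<lambda>_. 1"]) auto
next
  case (insert z0 Z)
  show ?case
  proof (cases "\<forall>k\<in>I. a z0 k = 0")
    case True
    have "card Z < card I" using insert by simp
    then obtain v where "\<exists>k\<in>I. v k \<noteq> 0" "\<forall>z\<in>Z. (\<Sum>k\<in>I. a z k * v k) = 0"
      using insert.IH insert.prems by blast
    then show ?thesis using True by (intro exI[of _ v]) auto
  next
    case False
    then obtain p where p: "p \<in> I" "a z0 p \<noteq> 0" by auto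
    define J where "J = I - {p}"
    have J: "finite J" "card Z < card J" "p \<notin> J" "I = insert p J"
      using insert p by (auto simp: J_def)
    obtain v where v: "\<exists>k\<in>J. v k \<noteq> 0"
      "\<forall>z\<in>Z. (\<Sum>k\<in>J. (a z k - a z p / a z0 p * a z0 k) * v k) = 0"
      using insert.IH[OF J(1,2), of "\<lambda>z k. a z k - a z p / a z0 p * a z0 k"] by blast
    define v' where "v' = v(p := - (\<Sum>k\<in>J. a z0 k * v k) / a z0 p)"
    have "(\<Sum>k\<in>I. a z k * v' k) = 0" if "z \<in> insert z0 Z" for z
      unfolding v'_def J(4) sum_eliminate_pivot[OF J(1,3)] using v(2) p(2) that by auto
    moreover have "\<exists>k\<in>I. v' k \<noteq> 0" using v(1) J by (auto simp: v'_def)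
    ultimately show ?thesis by blast
  qed
qed

lemma homogeneous_inequalities_solution:
  fixes a :: "'z \<Rightarrow> 'k \<Rightarrow> 'a::linordered_field"
  assumes "finite Z" "finite I" "I \<noteq> {}" "card Z \<le> card I"
  shows "\<exists>v. (\<exists>k\<in>I. v k \<noteq> 0) \<and> (\<forall>z\<in>Z. 0 \<le> (\<Sum>k\<in>I. a z k * v k))"
proof (cases "Z = {}")
  case True
  then show ?thesis using assms(3) by (intro exI[of _ "\<lambda>_. 1"]) auto
next
  case False
  then obtain z0 where z0: "z0 \<in> Z" by auto
  then have "card (Z - {z0}) < card I"
    using assms card_Diff1_less[of Z z0] by linarith
  then obtain v where v: "\<exists>k\<in>I. v k \<noteq> 0" "\<forall>z\<in>Z - {z0}. (\<Sum>k\<in>I. a z k * v k) = 0"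
    using underdetermined_homogeneous_solution[of "Z - {z0}" I a] assms by auto
  show ?thesis
  proof (cases "0 \<le> (\<Sum>k\<in>I. a z0 k * v k)")
    case True
    have "0 \<le> (\<Sum>k\<in>I. a z k * v k)" if "z \<in> Z" for z
      using True v(2) that by (cases "z = z0") auto
    then show ?thesis using v(1) by blast
  next
    case False
    have "0 \<le> (\<Sum>k\<in>I. a z k * - v k)" if "z \<in> Z" for z
      using False v(2) that by (cases "z = z0") (auto simp: sum_negf)
    then show ?thesis using v(1) by (intro exI[of _ "\<lambda>k. - v k"]) auto
  qed
qed

section \<open>Compactness and suprema\<close>

lemma eventually_ball_compact:
  assumes "compact C" and near: "\<And>z. z \<in> C \<Longrightarrow> eventually P (F \<times>\<^sub>F nhds z)"
  shows "\<forall>\<^sub>F x in F. \<forall>z\<in>C. P (x, z)"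
proof -
  have "\<exists>Q U. eventually Q F \<and> open U \<and> z \<in> U \<and> (\<forall>x t. Q x \<longrightarrow> t \<in> U \<longrightarrow> P (x, t))" if "z \<in> C" for z
    using near[OF that] unfolding eventually_prod_filter eventually_nhds by meson
  then obtain Q U where Q: "\<And>z. z \<in> C \<Longrightarrow> eventually (Q z) F"
    and U: "\<And>z. z \<in> C \<Longrightarrow> open (U z)" "\<And>z. z \<in> C \<Longrightarrow> z \<in> U z"
    and P: "\<And>z x t. z \<in> C \<Longrightarrow> Q z x \<Longrightarrow> t \<in> U z \<Longrightarrow> P (x, t)"
    by metis
  obtain D where D: "D \<subseteq> C" "finite D" "C \<subseteq> (\<Union>z\<in>D. U z)"
    using compactE_image[OF \<open>compact C\<close>, of C U] U by blast
  then have "\<forall>\<^sub>F x in F. \<forall>z\<in>D. Q z x" using Q by (intro eventually_ball_finite) auto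
  then show ?thesis by eventually_elim (use D P in blast)
qed

lemma SUP_closure:
  fixes f :: "'a::topological_space \<Rightarrow> 'b::{complete_linorder, linorder_topology}"
  assumes "continuous_on (closure S) f"
  shows "(SUP t\<in>closure S. f t) = (SUP t\<in>S. f t)"
proof (rule antisym)
  have "f ` closure S \<subseteq> {..SUP t\<in>S. f t}"
    by (rule image_closure_subset[OF assms]) (auto intro: SUP_upper)
  then show "(SUP t\<in>closure S. f t) \<le> (SUP t\<in>S. f t)" by (auto intro: SUP_least)
qed (simp add: SUP_subset_mono closure_subset)

lemma INF_SUP_attained_compact:
  fixes f :: "'a::topological_space \<Rightarrow> 'b \<Rightarrow>
    'c::{complete_linorder, dense_linorder, linorder_topology}"
  assumes "compact C" "C \<noteq> {}" and cont: "\<And>t. t \<in> T \<Longrightarrow> continuous_on UNIV (\<lambda>y. f y t)"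
  shows "\<exists>y\<in>C. (SUP t\<in>T. f y t) = (INF y\<in>C. SUP t\<in>T. f y t)"
proof (rule ccontr)
  define M where "M = (INF y\<in>C. SUP t\<in>T. f y t)"
  assume "\<not> ?thesis"
  then have above: "M < (SUP t\<in>T. f y t)" if "y \<in> C" for y
    using that INF_lower[OF that, of "\<lambda>y. SUP t\<in>T. f y t"] unfolding M_def by (metis order_le_less)
  define I where "I = {M<..} \<times> T"
  define U where "U = (\<lambda>(c, t). {y. c < f y t})"
  have cover: "C \<subseteq> (\<Union>i\<in>I. U i)"
  proof
    fix y assume "y \<in> C"
    then obtain t where "t \<in> T" "M < f y t" using above[OF \<open>y \<in> C\<close>] unfolding less_SUP_iff by blast
    moreover from this obtain c where "M < c" "c < f y t" using dense by blast
    ultimately have "(c, t) \<in> I" "y \<in> U (c, t)" by (simp_all add: I_def U_def)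
    then show "y \<in> (\<Union>i\<in>I. U i)" by blast
  qed
  have "open (U i)" if "i \<in> I" for i
    using that cont by (auto simp: I_def U_def intro!: open_Collect_less continuous_on_const)
  then obtain J where J: "J \<subseteq> I" "finite J" "C \<subseteq> (\<Union>i\<in>J. U i)"
    by (rule compactE_image[OF \<open>compact C\<close> _ cover])
  then have "J \<noteq> {}" using \<open>C \<noteq> {}\<close> by auto
  define c where "c = Min (fst ` J)"
  have "c \<in> fst ` J" unfolding c_def using J \<open>J \<noteq> {}\<close> by (intro Min_in) auto
  then have "M < c" using J by (auto simp: I_def)
  moreover have "c \<le> (SUP t\<in>T. f y t)" if y: "y \<in> C" for y
  proof -
    obtain i where "i \<in> J" "y \<in> U i" using J(3) y by blast
    then obtain c' t where active: "(c', t) \<in> J" "c' < f y t" by (cases i) (auto simp: U_def)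
    then have "c' \<in> fst ` J" by force
    then have "c \<le> c'" unfolding c_def using J(2) by (intro Min_le) auto
    moreover have "t \<in> T" using active(1) J(1) by (auto simp: I_def)
    ultimately show ?thesis using active(2) by (intro SUP_upper2[of t]) auto
  qed
  then have "c \<le> M" unfolding M_def by (rule INF_greatest)
  ultimately show False by simp
qed

lemma tendsto_sum_ereal:
  fixes f :: "'i \<Rightarrow> 'a \<Rightarrow> ereal"
  assumes "\<And>i. i \<in> A \<Longrightarrow> (f i \<longlongrightarrow> l i) F" "\<And>i. i \<in> A \<Longrightarrow> l i \<noteq> \<infinity>"
  shows "((\<lambda>x. \<Sum>i\<in>A. f i x) \<longlongrightarrow> (\<Sum>i\<in>A. l i)) F"
  using assms
proof (induction A rule: infinite_finite_induct)
  case (insert i A)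
  have "(\<Sum>i\<in>A. l i) \<noteq> \<infinity>" using insert by (auto simp: sum_Pinfty)
  then have "((\<lambda>x. f i x + (\<Sum>i\<in>A. f i x)) \<longlongrightarrow> l i + (\<Sum>i\<in>A. l i)) F"
    using insert by (intro tendsto_add_ereal_general) auto
  then show ?case using insert.hyps by simp
qed auto

section \<open>Monotone finite sequences\<close>

lemma sorting_permutation:
  fixes w :: "nat \<Rightarrow> 'a::linorder"
  shows "\<exists>\<sigma>. \<sigma> permutes {1..n} \<and> mono_on {1..n} (w \<circ> \<sigma>)"
proof -
  define xs where "xs = sort_key w [1..<n + 1]"
  have xs: "set xs = {1..n}" "distinct xs" "length xs = n" "sorted (map w xs)"
    by (auto simp: xs_def)
  define \<sigma> where "\<sigma> k = (if k \<in> {1..n} then xs ! (k - 1) else k)" for k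
  have "inj_on \<sigma> {1..n}"
    unfolding inj_on_def \<sigma>_def using xs by (auto simp: nth_eq_iff_index_eq)
  moreover have "\<sigma> ` {1..n} \<subseteq> {1..n}"
    using xs nth_mem[of _ xs] by (auto simp: \<sigma>_def)
  ultimately have "bij_betw \<sigma> {1..n} {1..n}"
    using endo_inj_surj[of "{1..n}" \<sigma>] by (simp add: bij_betw_def)
  then have "\<sigma> permutes {1..n}"
    by (rule bij_imp_permutes) (auto simp: \<sigma>_def)
  moreover have "mono_on {1..n} (w \<circ> \<sigma>)"
    using sorted_nth_mono[OF xs(4)] xs(3) by (intro mono_onI) (simp add: \<sigma>_def diff_le_mono)
  ultimately show ?thesis by blast
qed

lemma mono_on_Icc_SucI:
  fixes f :: "nat \<Rightarrow> 'a::order"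
  assumes "\<And>k. a \<le> k \<Longrightarrow> k < b \<Longrightarrow> f k \<le> f (Suc k)"
  shows "mono_on {a..b} f"
proof (rule mono_onI)
  fix r s assume "r \<in> {a..b}" "s \<in> {a..b}" "r \<le> s"
  from \<open>r \<le> s\<close> \<open>s \<in> {a..b}\<close> show "f r \<le> f s"
  proof (induction s rule: dec_induct)
    case (step k)
    then have "f r \<le> f k" "f k \<le> f (Suc k)" using assms[of k] \<open>r \<in> {a..b}\<close> by simp_all
    then show ?case by (rule order_trans)
  qed simp
qed

lemma strict_mono_on_Icc_SucI:
  fixes f :: "nat \<Rightarrow> 'a::order"
  assumes "\<And>k. a \<le> k \<Longrightarrow> k < b \<Longrightarrow> f k < f (Suc k)"
  shows "strict_mono_on {a..b} f"
proof (rule strict_mono_onI)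
  fix r s assume "r \<in> {a..b}" "s \<in> {a..b}" "r < s"
  then have "f r < f (Suc r)" using assms by simp
  also have "mono_on {a..b} f" using assms by (intro mono_on_Icc_SucI less_imp_le)
  then have "f (Suc r) \<le> f s"
    using \<open>r \<in> {a..b}\<close> \<open>s \<in> {a..b}\<close> \<open>r < s\<close> by (intro mono_onD[of "{a..b}" f]) auto
  finally show "f r < f s" .
qed

lemma eventually_strict_mono_on_add_scaled:
  fixes f g :: "'a::linorder \<Rightarrow> real"
  assumes "finite A" "strict_mono_on A f"
  shows "\<forall>\<^sub>F s in at 0. strict_mono_on A (\<lambda>k. f k + s * g k)"
proof -
  have "\<forall>\<^sub>F s in at 0. i < j \<longrightarrow> f i + s * g i < f j + s * g j" if "i \<in> A" "j \<in> A" for i j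
  proof (cases "i < j")
    case True
    have scaled: "((\<lambda>s. f k + s * g k) \<longlongrightarrow> f k) (at 0)" for k
      by (auto intro!: tendsto_eq_intros)
    have "f i < f j" using assms(2) that True by (rule strict_mono_onD)
    then show ?thesis
      using order_tendstoD(1)[OF tendsto_diff[OF scaled[of j] scaled[of i]], of 0] by simp
  qed simp
  then have "\<forall>\<^sub>F s in at 0. \<forall>i\<in>A. \<forall>j\<in>A. i < j \<longrightarrow> f i + s * g i < f j + s * g j"
    using \<open>finite A\<close> by (intro eventually_ball_finite ballI)
  then show ?thesis by eventually_elim (simp add: strict_mono_on_def)
qed

section \<open>Concave kernels\<close>

definition branch :: "int \<Rightarrow> real set" where
  "branch l = {2 * pi * of_int l<..<2 * pi * (of_int l + 1)}"

lemma reduce_mod_2pi: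
  obtains l :: int where "x - 2 * pi * of_int l \<in> {0..<2*pi}"
proof -
  define l where "l = \<lfloor>x / (2 * pi)\<rfloor>"
  have "of_int l \<le> x / (2 * pi)" "x / (2 * pi) < of_int l + 1" by (auto simp: l_def)
  then have "x - 2 * pi * of_int l \<in> {0..<2*pi}" by (auto simp: field_simps)
  then show ?thesis by (rule that)
qed

lemma open_branch: "open (branch l)"
  by (simp add: branch_def)

lemma convex_branch: "convex (branch l)"
  by (simp add: branch_def)

lemma branch_shift_iff: "x \<in> branch l \<longleftrightarrow> x - 2 * pi * of_int l \<in> {0<..<2*pi}"
  by (auto simp: branch_def algebra_simps)

lemma branch_0: "branch 0 = {0<..<2*pi}"
  by (simp add: branch_def)

lemma branch_minus_1: "branch (- 1) = {- (2*pi)<..<0}"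
  by (simp add: branch_def)

lemma branch_cases:
  fixes x :: real
  obtains (lattice) l where "x = 2 * pi * of_int l" | (branch) l where "x \<in> branch l"
proof -
  obtain l :: int where l: "x - 2 * pi * of_int l \<in> {0..<2*pi}" by (rule reduce_mod_2pi)
  show ?thesis
  proof (cases "x = 2 * pi * of_int l")
    case False
    then have "x \<in> branch l" using l by (auto simp: branch_shift_iff)
    then show ?thesis by (rule branch)
  qed (rule lattice)
qed

lemma eventually_in_branch: "\<forall>\<^sub>F h in at 0. \<exists>l. x + h \<in> branch l"
proof (cases x rule: branch_cases)
  case (lattice l)
  have "\<forall>\<^sub>F h in at (0::real). h \<in> {- (2*pi)<..<2*pi} - {0}"
    by (rule eventually_at_in_open) auto
  then show ?thesis
  proof eventually_elim
    case (elim h)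
    then show ?case using lattice
      by (cases "h > 0") (auto simp: branch_def algebra_simps intro: exI[of _ l] exI[of _ "l - 1"])
  qed
next
  case (branch l)
  have "((\<lambda>h. x + h) \<longlongrightarrow> x) (at 0)" by (auto intro!: tendsto_eq_intros)
  then have "\<forall>\<^sub>F h in at 0. x + h \<in> branch l"
    using topological_tendstoD[OF _ open_branch branch] by blast
  then show ?thesis by eventually_elim auto
qed

abbreviation real_kernel :: "(real \<Rightarrow> ereal) \<Rightarrow> real \<Rightarrow> real" where
  "real_kernel K \<equiv> \<lambda>t. real_of_ereal (K t)"

context
  fixes K :: "real \<Rightarrow> ereal"
  assumes K: "strictly_concave_kernel K"
begin

lemma kernel_base: "kernel_base K"
  using K by (simp add: strictly_concave_kernel_def concave_kernel_def)

lemma kernel_not_PInf: "K t \<noteq> \<infinity>"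
  using kernel_base by (simp add: kernel_base_def)

lemma kernel_periodic: "K (t + 2 * pi * of_int l) = K t"
proof -
  have period: "K (t + 2 * pi) = K t" for t using kernel_base by (simp add: kernel_base_def)
  have nat: "K (t + 2 * pi * real m) = K t" for m t
  proof (induction m)
    case (Suc m)
    then show ?case using period[of "t + 2 * pi * real m"] by (simp add: algebra_simps)
  qed simp
  show ?thesis
  proof (cases l rule: int_cases2)
    case (nonneg m)
    then show ?thesis using nat[of t m] by simp
  next
    case (nonpos m)
    then show ?thesis using nat[of "t - 2 * pi * real m" m] by simp
  qed
qed

lemma kernel_shift: "K (t - 2 * pi * of_int l) = K t"
  using kernel_periodic[of t "- l"] by simp

lemma kernel_2pi: "K (2*pi) = K 0"
  using kernel_periodic[of 0 1] by simp

lemma kernel_finite: "x \<in> branch l \<Longrightarrow> \<bar>K x\<bar> \<noteq> \<infinity>"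
  using kernel_base kernel_shift[of x l] unfolding kernel_base_def branch_shift_iff
  by (metis ereal_infinity_cases)

lemma kernel_strictly_concave: "strictly_concave_on (branch l) (real_kernel K)"
proof -
  have "strictly_concave_on {0<..<2*pi} (real_kernel K)"
    using K by (simp add: strictly_concave_kernel_def)
  from strictly_concave_on_compose_affine[OF this, of 1 "- (2 * pi * of_int l)"]
  have "strictly_concave_on ((\<lambda>t. t - 2 * pi * of_int l) -` {0<..<2*pi})
      (real_kernel (\<lambda>t. K (t - 2 * pi * of_int l)))"
    by simp
  moreover have "(\<lambda>t. t - 2 * pi * of_int l) -` {0<..<2*pi} = branch l"
    by (auto simp: branch_shift_iff)
  ultimately show ?thesis by (simp add: kernel_shift)
qed

lemma kernel_concave: "concave_on (branch l) (real_kernel K)"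
  using kernel_strictly_concave by (rule strictly_concave_on_imp_concave_on)

lemma isCont_kernel_0: "isCont K 0"
proof -
  have right: "(K \<longlongrightarrow> K 0) (at_right 0)" and left: "(K \<longlongrightarrow> K 0) (at_left (2*pi))"
    using kernel_base by (auto simp: kernel_base_def)
  have "filterlim (\<lambda>t. t + 2 * pi) (at_left (2*pi)) (at_left 0)"
    unfolding filterlim_at by (auto intro!: tendsto_eq_intros simp: eventually_at_filter)
  from filterlim_compose[OF left this] have "(K \<longlongrightarrow> K 0) (at_left 0)"
    using kernel_periodic[of _ 1] by simp
  with right show ?thesis by (simp add: isCont_def filterlim_split_at)
qed

lemma isCont_kernel_branch_0:
  assumes "x \<in> branch 0"
  shows "isCont K x"
proof -
  have "continuous_on (branch 0) (\<lambda>t. - real_kernel K t)"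
    using kernel_concave by (intro convex_on_continuous open_branch) (simp add: concave_on_def)
  then have "continuous_on (branch 0) (\<lambda>t. - (- real_kernel K t))" by (rule continuous_on_minus)
  then have "continuous_on (branch 0) (\<lambda>t. ereal (real_kernel K t))"
    by (intro continuous_on_ereal) simp
  moreover have "ereal (real_kernel K t) = K t" if "t \<in> branch 0" for t
    using kernel_finite[OF that] by (rule ereal_real')
  ultimately have "continuous_on (branch 0) K" by simp
  then show ?thesis using assms by (simp add: continuous_on_eq_continuous_at open_branch)
qed

lemma isCont_kernel: "isCont K x"
proof -
  obtain l :: int where "x - 2 * pi * of_int l \<in> {0..<2*pi}" by (rule reduce_mod_2pi)
  then consider "x - 2 * pi * of_int l = 0" | "x - 2 * pi * of_int l \<in> branch 0"
    unfolding branch_0 by fastforce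
  then have "isCont K (x - 2 * pi * of_int l)"
    by cases (simp_all only: isCont_kernel_0 isCont_kernel_branch_0)
  then have "((\<lambda>t. K (t - 2 * pi * of_int l)) \<longlongrightarrow> K (x - 2 * pi * of_int l)) (at x)"
    by (rule isCont_tendsto_compose) (intro tendsto_intros)
  then show ?thesis by (simp add: kernel_shift isCont_def)
qed

lemma kernel_reflect: "strictly_concave_kernel (\<lambda>t. K (- t))"
proof -
  have "strictly_concave_on (uminus ` branch (- 1)) (real_kernel (\<lambda>t. K (- t)))"
    using strictly_concave_on_compose_affine[OF kernel_strictly_concave[of "- 1"], of "- 1" 0]
    by (simp add: minus_image_eq_vimage)
  then have concave: "strictly_concave_on {0<..<2*pi} (real_kernel (\<lambda>t. K (- t)))"
    by (simp add: branch_minus_1)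
  have "K (- t - 2 * pi) = K (- t)" for t using kernel_shift[of "- t" 1] by simp
  moreover have "K (- t) \<noteq> - \<infinity>" if "t \<in> {0<..<2*pi}" for t
    using kernel_finite[of "- t" "- 1"] that by (auto simp: branch_minus_1)
  moreover have "((\<lambda>t. K (- t)) \<longlongrightarrow> K (- x)) (at x within A)" for x A
    by (rule isCont_tendsto_compose[OF isCont_kernel]) (intro tendsto_intros)
  from this[of 0] this[of "2*pi"]
  have "((\<lambda>t. K (- t)) \<longlongrightarrow> K 0) (at_right 0)" "((\<lambda>t. K (- t)) \<longlongrightarrow> K 0) (at_left (2*pi))"
    using kernel_periodic[of 0 "- 1"] by simp_all
  ultimately have "kernel_base (\<lambda>t. K (- t))"
    by (simp add: kernel_base_def kernel_not_PInf)
  then show ?thesis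
    using concave
    by (simp add: strictly_concave_kernel_def concave_kernel_def strictly_concave_on_imp_concave_on)
qed

lemma lower_right_slope_kernel_lattice:
  "lower_right_slope (real_kernel K) (2 * pi * of_int l) s \<longleftrightarrow> lower_right_slope (real_kernel K) 0 s"
  using kernel_periodic[of _ l] kernel_periodic[of 0 l]
  by (simp add: lower_right_slope_def add.commute[of "2 * pi * of_int l"])

context
  assumes finite_0: "K 0 \<noteq> -\<infinity>"
begin

lemma kernel_finite_everywhere: "\<bar>K x\<bar> \<noteq> \<infinity>"
proof (cases x rule: branch_cases)
  case (lattice l)
  then have "K x = K 0" using kernel_periodic[of 0 l] by simp
  then show ?thesis using finite_0 kernel_not_PInf[of 0] by auto
qed (rule kernel_finite)

lemma kernel_concave_closed: "concave_on {0..2*pi} (real_kernel K)"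
proof -
  have "isCont (real_kernel K) x" for x
    using isCont_kernel[of x] kernel_finite_everywhere[of x] unfolding isCont_def
    by (auto intro!: lim_real_of_ereal simp: ereal_real')
  then have "continuous_on (closure (branch 0)) (real_kernel K)"
    by (simp add: continuous_at_imp_continuous_on)
  then have "concave_on (closure (branch 0)) (real_kernel K)"
    by (rule concave_on_closure[OF kernel_concave])
  then show ?thesis by (simp add: branch_0)
qed

lemma kernel_0_less_pi: "real_kernel K 0 < real_kernel K pi"
proof -
  have boundary_le: "real_kernel K 0 \<le> real_kernel K x" if "x \<in> {0..2*pi}" for x
  proof -
    define u where "u = x / (2*pi)"
    have u: "0 \<le> u" "u \<le> 1" "u * (2*pi) = x" using that by (auto simp: u_def)
    then have "(1 - u) * real_kernel K 0 + u * real_kernel K (2*pi) \<le> real_kernel K x"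
      using concave_onD[OF kernel_concave_closed, of u 0 "2*pi"] by simp
    then show ?thesis unfolding kernel_2pi by (simp add: algebra_simps)
  qed
  have "(real_kernel K (pi / 2) + real_kernel K (3 * pi / 2)) / 2
      < real_kernel K ((pi / 2 + 3 * pi / 2) / 2)"
    using kernel_strictly_concave[of 0] by (rule strictly_concave_on_midpoint) (auto simp: branch_0)
  then show ?thesis using boundary_le[of "pi / 2"] boundary_le[of "3 * pi / 2"] by simp
qed

lemma lower_right_slope_kernel_0:
  "lower_right_slope (real_kernel K) 0 ((real_kernel K pi - real_kernel K 0) / pi)"
proof -
  have "\<forall>\<^sub>F h in at_right 0. h \<in> {0<..<pi}" by (intro eventually_at_right_real) auto
  then show ?thesis unfolding lower_right_slope_def
  proof eventually_elim
    case (elim h)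
    then have "(real_kernel K pi - real_kernel K 0) / pi \<le> (real_kernel K h - real_kernel K 0) / h"
      using concave_on_slope_le(1)[OF kernel_concave_closed, of 0 pi h] by simp
    then show ?case using elim by (simp add: pos_le_divide_eq)
  qed
qed

lemma infinite_right_slope_kernel_0:
  assumes "filterlim (Dplus (real_kernel K)) at_top (at_right 0)"
  shows "lower_right_slope (real_kernel K) 0 s"
proof -
  have "\<forall>\<^sub>F h in at_right 0. s \<le> Dplus (real_kernel K) h"
    using assms by (simp add: filterlim_at_top)
  moreover have "\<forall>\<^sub>F h in at_right 0. h \<in> {0<..<2*pi}" by (intro eventually_at_right_real) auto
  ultimately show ?thesis unfolding lower_right_slope_def
  proof eventually_elim
    case (elim h)
    then have "s \<le> (real_kernel K h - real_kernel K 0) / h"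
      using Dplus_le_slope[OF kernel_concave_closed, of h 0] by simp
    then show ?case using elim by (simp add: pos_le_divide_eq)
  qed
qed

lemma infinite_left_slope_kernel_2pi:
  assumes "filterlim (Dplus (real_kernel K)) at_bot (at_left (2*pi))"
  shows "lower_right_slope (\<lambda>t. real_kernel K (- t)) 0 s"
proof -
  have "filterlim (\<lambda>h. 2 * pi - h) (at_left (2*pi)) (at_right 0)"
    unfolding filterlim_at by (auto intro!: tendsto_eq_intros simp: eventually_at_filter)
  then have "filterlim (\<lambda>h. Dplus (real_kernel K) (2 * pi - h)) at_bot (at_right 0)"
    by (rule filterlim_compose[OF assms])
  then have "\<forall>\<^sub>F h in at_right 0. Dplus (real_kernel K) (2 * pi - h) \<le> - s"
    by (simp add: filterlim_at_bot)
  moreover have "\<forall>\<^sub>F h in at_right 0. h \<in> {0<..<2*pi}" by (intro eventually_at_right_real) auto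
  ultimately show ?thesis unfolding lower_right_slope_def
  proof eventually_elim
    case (elim h)
    then have "(real_kernel K (2*pi) - real_kernel K (2 * pi - h)) / h \<le> - s"
      using Dplus_ge_slope[OF kernel_concave_closed, of "2 * pi - h" "2*pi"] by simp
    then have "real_kernel K 0 - real_kernel K (2 * pi - h) \<le> - s * h"
      using elim by (simp add: pos_divide_le_eq kernel_2pi)
    moreover have "K (2 * pi - h) = K (- h)" using kernel_periodic[of "- h" 1] by simp
    ultimately show ?case by simp
  qed
qed

end

lemma lower_right_slope_kernel_exists:
  assumes "\<bar>K x\<bar> \<noteq> \<infinity>"
  shows "\<exists>s. lower_right_slope (real_kernel K) x s"
proof (cases x rule: branch_cases)
  case (lattice l)
  then have "K 0 \<noteq> -\<infinity>" using assms kernel_periodic[of 0 l] by auto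
  from lower_right_slope_kernel_0[OF this] show ?thesis
    unfolding lattice lower_right_slope_kernel_lattice by blast
next
  case (branch l)
  then show ?thesis
    using lower_right_slope_less_Dplus[OF kernel_concave, of x l "Dplus (real_kernel K) x - 1"]
    by (auto simp: interior_open open_branch)
qed

lemma C1_kernel_differentiable:
  assumes "C1_kernel K" "x \<in> branch l"
  shows "\<exists>D. (real_kernel K has_real_derivative D) (at x)"
proof -
  obtain D where "(real_kernel K has_real_derivative D) (at (x + - (2 * pi * of_int l)))"
    using assms unfolding C1_kernel_def branch_shift_iff add_uminus_conv_diff by blast
  then have "((\<lambda>t. real_kernel K (t + - (2 * pi * of_int l))) has_real_derivative D) (at x)"
    by (simp only: DERIV_shift)
  then show ?thesis by (auto simp: kernel_shift)
qed

end

lemma kernel_infinite_slope: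
  assumes K: "strictly_concave_kernel K" and "cond_infty' K" "K 0 \<noteq> -\<infinity>"
  shows "(\<forall>s. lower_right_slope (real_kernel K) (2 * pi * of_int l) s) \<or>
    (\<forall>s. lower_left_slope (real_kernel K) (2 * pi * of_int l) s)"
proof -
  consider (left) "filterlim (Dplus (real_kernel K)) at_bot (at_left (2*pi))"
    | (right) "filterlim (Dplus (real_kernel K)) at_top (at_right 0)"
    using assms(2) by (auto simp: cond_infty'_def Let_def)
  then show ?thesis
  proof cases
    case left
    then have "lower_right_slope (real_kernel (\<lambda>t. K (- t))) 0 s" for s
      by (rule infinite_left_slope_kernel_2pi[OF K assms(3)])
    then show ?thesis
      using lower_right_slope_kernel_lattice[OF kernel_reflect[OF K], of "- l"] by simp
  next
    case right
    then show ?thesis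
      using infinite_right_slope_kernel_0[OF K assms(3)]
      by (simp add: lower_right_slope_kernel_lattice[OF K])
  qed
qed

lemma kernel_convex_kink:
  assumes K: "strictly_concave_kernel K" and "K 0 \<noteq> -\<infinity>"
  obtains s where "0 < s" "lower_right_slope (real_kernel K) (2 * pi * of_int l) s"
    "lower_left_slope (real_kernel K) (2 * pi * of_int l) s"
proof -
  define s where "s = (real_kernel K pi - real_kernel K 0) / pi"
  have "K (- pi) = K pi" using kernel_periodic[OF K, of "- pi" 1] by simp
  then have "lower_right_slope (real_kernel (\<lambda>t. K (- t))) 0 s"
    using lower_right_slope_kernel_0[OF kernel_reflect[OF K]] assms(2) by (simp add: s_def)
  moreover have "lower_right_slope (real_kernel K) 0 s"
    using lower_right_slope_kernel_0[OF K assms(2)] by (simp add: s_def)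
  moreover have "0 < s" using kernel_0_less_pi[OF K assms(2)] by (simp add: s_def)
  ultimately show ?thesis
    using that lower_right_slope_kernel_lattice[OF K, of l]
      lower_right_slope_kernel_lattice[OF kernel_reflect[OF K], of "- l"] by simp
qed

lemma C1_kernel_opposite_slopes:
  assumes K: "strictly_concave_kernel K" and "C1_kernel K" "\<bar>K x\<bar> \<noteq> \<infinity>" "0 < \<epsilon>"
  shows "\<exists>s s'. lower_right_slope (real_kernel K) x s \<and>
    lower_left_slope (real_kernel K) x s' \<and> - \<epsilon> \<le> s + s'"
proof (cases x rule: branch_cases)
  case (lattice l)
  then have "K 0 \<noteq> -\<infinity>" using assms(3) kernel_periodic[OF K, of 0 l] by auto
  then obtain s where "0 < s" "lower_right_slope (real_kernel K) x s"
      "lower_left_slope (real_kernel K) x s"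
    unfolding lattice by (rule kernel_convex_kink[OF K])
  moreover from \<open>0 < s\<close> have "- \<epsilon> \<le> s + s" using \<open>0 < \<epsilon>\<close> by linarith
  ultimately show ?thesis by blast
next
  case (branch l)
  obtain D where D: "(real_kernel K has_real_derivative D) (at x)"
    using C1_kernel_differentiable[OF K assms(2) branch] by blast
  then have "(real_kernel (\<lambda>t. K (- t)) has_real_derivative - D) (at (- x))"
    using DERIV_mirror[where f = "real_kernel K" and x = "- x" and y = D] by simp
  then have "lower_left_slope (real_kernel K) x (- D - \<epsilon> / 2)"
    using \<open>0 < \<epsilon>\<close> by (intro lower_right_slope_less_deriv) auto
  moreover have "lower_right_slope (real_kernel K) x (D - \<epsilon> / 2)"
    using D \<open>0 < \<epsilon>\<close> by (intro lower_right_slope_less_deriv) auto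
  moreover have "- \<epsilon> \<le> (D - \<epsilon> / 2) + (- D - \<epsilon> / 2)" by simp
  ultimately show ?thesis by blast
qed

section \<open>Sums of translated kernels\<close>

lemma ynode_affine_combination:
  assumes "u + v = 1"
  shows "ynode n (\<lambda>j. u * x j + v * y j) k = u * ynode n x k + v * ynode n y k"
proof -
  have "u * (2*pi) + v * (2*pi) = 2*pi" using assms by (simp flip: distrib_right)
  then show ?thesis by (simp add: ynode_def)
qed

lemma Fsum_eq_sum: "Fsum n K y t = (\<Sum>j\<le>n. K j (t - ynode n y j))"
proof -
  have "{..n} = insert 0 {1..n}" by auto
  then have "(\<Sum>j\<le>n. K j (t - ynode n y j)) = K 0 t + (\<Sum>j\<in>{1..n}. K j (t - ynode n y j))"
    by (simp add: ynode_def)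
  also have "(\<Sum>j\<in>{1..n}. K j (t - ynode n y j)) = (\<Sum>j\<in>{1..n}. K j (t - y j))"
    by (rule sum.cong) (auto simp: ynode_def)
  finally show ?thesis by (simp add: Fsum_def)
qed

lemma Fsum_reflect: "Fsum n (\<lambda>j t. K j (- t)) (\<lambda>j. - y j) t = Fsum n K y (- t)"
  by (simp add: Fsum_def algebra_simps)

locale kernel_system =
  fixes n :: nat and K :: "nat \<Rightarrow> real \<Rightarrow> ereal"
  assumes kernel: "j \<le> n \<Longrightarrow> strictly_concave_kernel (K j)"
begin

abbreviation \<kappa> :: "nat \<Rightarrow> real \<Rightarrow> real" where
  "\<kappa> j \<equiv> real_kernel (K j)"

abbreviation F :: "(nat \<Rightarrow> real) \<Rightarrow> real \<Rightarrow> ereal" where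
  "F \<equiv> Fsum n K"

lemma kernel_system_reflect: "kernel_system n (\<lambda>j t. K j (- t))"
  by unfold_locales (rule kernel_reflect[OF kernel])

lemma F_eq_real:
  assumes "\<And>j. j \<le> n \<Longrightarrow> \<bar>K j (t - ynode n y j)\<bar> \<noteq> \<infinity>"
  shows "F y t = ereal (\<Sum>j\<le>n. \<kappa> j (t - ynode n y j))"
proof -
  have "F y t = (\<Sum>j\<le>n. ereal (\<kappa> j (t - ynode n y j)))"
    unfolding Fsum_eq_sum by (rule sum.cong) (use assms in \<open>auto simp: ereal_real\<close>)
  then show ?thesis by simp
qed

lemma F_finite_imp_kernel_finite:
  assumes "F y t \<noteq> -\<infinity>" "j \<le> n"
  shows "\<bar>K j (t - ynode n y j)\<bar> \<noteq> \<infinity>"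
proof -
  have "F y t = K j (t - ynode n y j) + (\<Sum>i\<in>{..n} - {j}. K i (t - ynode n y i))"
    unfolding Fsum_eq_sum using assms(2) by (intro sum.remove) auto
  moreover have "(\<Sum>i\<in>{..n} - {j}. K i (t - ynode n y i)) \<noteq> \<infinity>"
    using kernel_not_PInf[OF kernel] by (auto simp: sum_Pinfty)
  ultimately have "K j (t - ynode n y j) \<noteq> -\<infinity>" using assms(1) by auto
  then show ?thesis using kernel_not_PInf[OF kernel[OF assms(2)]] by auto
qed

lemma F_tendsto:
  assumes "\<And>j. j \<le> n \<Longrightarrow> ((\<lambda>x. ynode n (Y x) j) \<longlongrightarrow> ynode n y j) G" and "(T \<longlongrightarrow> t) G"
  shows "((\<lambda>x. F (Y x) (T x)) \<longlongrightarrow> F y t) G"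
  unfolding Fsum_eq_sum
proof (rule tendsto_sum_ereal)
  fix j assume "j \<in> {..n}"
  then show "((\<lambda>x. K j (T x - ynode n (Y x) j)) \<longlongrightarrow> K j (t - ynode n y j)) G"
    using assms by (intro isCont_tendsto_compose[OF isCont_kernel[OF kernel]] tendsto_diff) auto
qed (simp add: kernel_not_PInf[OF kernel])

lemma continuous_F: "continuous_on A (F y)"
proof -
  have "isCont (F y) t" for t
    unfolding isCont_def by (rule F_tendsto) (rule tendsto_const tendsto_ident_at)+
  then show ?thesis by (simp add: continuous_at_imp_continuous_on)
qed

lemma continuous_F_nodes: "continuous_on UNIV (\<lambda>y. F y t)"
proof -
  have "continuous_on UNIV (\<lambda>y :: nat \<Rightarrow> real. y j)" for j by simp
  then have coordinate: "((\<lambda>y. y j) \<longlongrightarrow> y j) (at y)" for y :: "nat \<Rightarrow> real" and j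
    unfolding continuous_on_def by simp
  have "((\<lambda>y. F y t) \<longlongrightarrow> F y t) (at y)" for y
    by (rule F_tendsto) (auto simp: ynode_def coordinate)
  then show ?thesis by (simp add: continuous_on_eq_continuous_at isCont_def)
qed

lemma F_periodic: "F y (t - 2 * pi * of_int l) = F y t"
  unfolding Fsum_eq_sum
proof (rule sum.cong)
  fix j assume "j \<in> {..n}"
  then show "K j (t - 2 * pi * of_int l - ynode n y j) = K j (t - ynode n y j)"
    using kernel_shift[OF kernel, of j "t - ynode n y j" l] by (simp add: algebra_simps)
qed simp

lemma F_reduce_nodes:
  obtains y' where "y' \<in> nodes n" "F y' = F y"
proof -
  have "\<forall>j. \<exists>l::int. y j - 2 * pi * of_int l \<in> {0..<2*pi}" using reduce_mod_2pi by metis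
  then obtain l :: "nat \<Rightarrow> int" where l: "\<And>j. y j - 2 * pi * of_int (l j) \<in> {0..<2*pi}" by metis
  define y' where "y' = restrict (\<lambda>j. y j - 2 * pi * of_int (l j)) {1..n}"
  have "(\<Sum>j\<in>{1..n}. K j (t - y' j)) = (\<Sum>j\<in>{1..n}. K j (t - y j))" for t
  proof (rule sum.cong)
    fix j assume "j \<in> {1..n}"
    then show "K j (t - y' j) = K j (t - y j)"
      using kernel_periodic[OF kernel, of j "t - y j" "l j"] by (simp add: y'_def algebra_simps)
  qed simp
  then have "F y' = F y" by (intro ext) (simp add: Fsum_def)
  moreover have "y' \<in> nodes n" using l by (auto simp: nodes_def y'_def)
  ultimately show ?thesis using that by blast
qed

section \<open>Maximum points\<close>

definition maximum_point :: "(nat \<Rightarrow> real) \<Rightarrow> real \<Rightarrow> bool" where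
  "maximum_point y c \<longleftrightarrow> (\<forall>t. F y t \<le> F y c)"

definition maximum_points :: "(nat \<Rightarrow> real) \<Rightarrow> real set" where
  "maximum_points y = {c \<in> {0..2*pi}. maximum_point y c}"

definition circle_sup :: "(nat \<Rightarrow> real) \<Rightarrow> ereal" where
  "circle_sup y = (SUP t\<in>{0..<2*pi}. F y t)"

lemma F_le_circle_sup: "F y t \<le> circle_sup y"
proof -
  obtain l :: int where "t - 2 * pi * of_int l \<in> {0..<2*pi}" by (rule reduce_mod_2pi)
  then have "F y (t - 2 * pi * of_int l) \<le> circle_sup y"
    unfolding circle_sup_def by (rule SUP_upper)
  then show ?thesis by (simp only: F_periodic)
qed

lemma maximum_point_iff: "maximum_point y c \<longleftrightarrow> F y c = circle_sup y"
proof
  assume "maximum_point y c"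
  then have "circle_sup y \<le> F y c"
    unfolding circle_sup_def maximum_point_def by (intro SUP_least) auto
  then show "F y c = circle_sup y" using F_le_circle_sup by (rule antisym[rotated])
qed (simp add: maximum_point_def F_le_circle_sup)

lemma maximum_point_exists:
  obtains c where "c \<in> {0..<2*pi}" "maximum_point y c"
proof -
  have "\<exists>s\<in>{0..2*pi}. \<forall>t\<in>{0..2*pi}. F y t \<le> F y s"
    by (rule continuous_attains_sup) (auto intro: continuous_F)
  then obtain s where s: "\<And>t. t \<in> {0..2*pi} \<Longrightarrow> F y t \<le> F y s" by blast
  have "circle_sup y \<le> F y s"
    unfolding circle_sup_def by (rule SUP_least) (use s in auto)
  then have "F y s = circle_sup y" using F_le_circle_sup by (rule antisym[rotated])
  moreover obtain l :: int where l: "s - 2 * pi * of_int l \<in> {0..<2*pi}" by (rule reduce_mod_2pi)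
  ultimately show ?thesis using that[OF l] by (simp only: maximum_point_iff F_periodic)
qed

lemma maximum_point_reflect:
  assumes "maximum_point y c"
  shows "kernel_system.maximum_point n (\<lambda>j t. K j (- t)) (\<lambda>j. - y j) (- c)"
  using assms unfolding maximum_point_def kernel_system.maximum_point_def[OF kernel_system_reflect]
  by (simp add: Fsum_reflect)

lemma eventually_kernels_finite:
  "\<forall>\<^sub>F h in at 0. \<forall>j\<in>{..n}. \<bar>K j (c + h - ynode n y j)\<bar> \<noteq> \<infinity>"
proof (intro eventually_ball_finite ballI)
  fix j assume "j \<in> {..n}"
  then have finite: "x \<in> branch l \<Longrightarrow> \<bar>K j x\<bar> \<noteq> \<infinity>" for x l
    by (intro kernel_finite[OF kernel]) auto
  have "\<forall>\<^sub>F h in at 0. \<exists>l. (c - ynode n y j) + h \<in> branch l" by (rule eventually_in_branch)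
  then show "\<forall>\<^sub>F h in at 0. \<bar>K j (c + h - ynode n y j)\<bar> \<noteq> \<infinity>"
    by eventually_elim (use finite in \<open>metis diff_add_eq\<close>)
qed simp

lemma maximum_point_kernel_finite:
  assumes "maximum_point y c" "j \<le> n"
  shows "\<bar>K j (c - ynode n y j)\<bar> \<noteq> \<infinity>"
proof -
  obtain h where "\<forall>j\<in>{..n}. \<bar>K j (c + h - ynode n y j)\<bar> \<noteq> \<infinity>"
    using eventually_happens'[OF at_neq_bot eventually_kernels_finite] by blast
  then have "F y (c + h) = ereal (\<Sum>j\<le>n. \<kappa> j (c + h - ynode n y j))"
    by (intro F_eq_real) simp
  moreover have "F y (c + h) \<le> F y c" using assms(1) by (simp add: maximum_point_def)
  ultimately have "F y c \<noteq> -\<infinity>" by auto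
  then show ?thesis using assms(2) by (rule F_finite_imp_kernel_finite)
qed

lemma maximum_point_lower_right_slopes:
  assumes max: "maximum_point y c"
    and slopes: "\<And>j. j \<le> n \<Longrightarrow> lower_right_slope (\<kappa> j) (c - ynode n y j) (s j)"
  shows "(\<Sum>j\<le>n. s j) \<le> 0"
proof (rule sum_lower_right_slopes_nonpos)
  have "\<forall>\<^sub>F h in at_right 0. \<forall>j\<in>{..n}. \<bar>K j (c + h - ynode n y j)\<bar> \<noteq> \<infinity>"
    using eventually_kernels_finite by (simp add: eventually_at_split)
  then show "\<forall>\<^sub>F h in at_right 0. (\<Sum>j\<le>n. \<kappa> j (c - ynode n y j + h))
      \<le> (\<Sum>j\<le>n. \<kappa> j (c - ynode n y j))"
  proof eventually_elim
    case (elim h)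
    have "F y (c + h) \<le> F y c" using max by (simp add: maximum_point_def)
    moreover have "F y (c + h) = ereal (\<Sum>j\<le>n. \<kappa> j (c + h - ynode n y j))"
      using elim by (intro F_eq_real) auto
    moreover have "F y c = ereal (\<Sum>j\<le>n. \<kappa> j (c - ynode n y j))"
      by (intro F_eq_real maximum_point_kernel_finite[OF max])
    ultimately show ?case by (simp add: algebra_simps)
  qed
qed (use slopes in auto)

lemma maximum_point_lower_left_slopes:
  assumes "maximum_point y c"
    and "\<And>j. j \<le> n \<Longrightarrow> lower_left_slope (\<kappa> j) (c - ynode n y j) (s j)"
  shows "(\<Sum>j\<le>n. s j) \<le> 0"
proof -
  interpret reflected: kernel_system n "\<lambda>j t. K j (- t)" by (rule kernel_system_reflect)
  show ?thesis
  proof (rule reflected.maximum_point_lower_right_slopes[OF maximum_point_reflect[OF assms(1)]])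
    fix j assume "j \<le> n"
    moreover from this have "- (c - ynode n y j) = - c - ynode n (\<lambda>j. - y j) j"
      by (simp add: ynode_def)
    ultimately show "lower_right_slope (reflected.\<kappa> j) (- c - ynode n (\<lambda>j. - y j) j) (s j)"
      using assms(2)[of j] by simp
  qed
qed

lemma maximum_point_bounded_right_slope:
  assumes max: "maximum_point y c" and i: "i \<le> n"
  shows "\<exists>s. \<not> lower_right_slope (\<kappa> i) (c - ynode n y i) s"
proof (rule ccontr)
  assume "\<not> ?thesis"
  then have unbounded: "lower_right_slope (\<kappa> i) (c - ynode n y i) s" for s by simp
  have "\<exists>s. lower_right_slope (\<kappa> j) (c - ynode n y j) s" if "j \<le> n" for j
    using kernel[OF that] maximum_point_kernel_finite[OF max that]
    by (rule lower_right_slope_kernel_exists)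
  then obtain s where s: "\<And>j. j \<le> n \<Longrightarrow> lower_right_slope (\<kappa> j) (c - ynode n y j) (s j)"
    by metis
  define s' where "s' = s(i := 1 - (\<Sum>j\<in>{..n} - {i}. s j))"
  have "(\<Sum>j\<le>n. s' j) = s' i + (\<Sum>j\<in>{..n} - {i}. s' j)" using i by (intro sum.remove) auto
  also have "(\<Sum>j\<in>{..n} - {i}. s' j) = (\<Sum>j\<in>{..n} - {i}. s j)"
    by (rule sum.cong) (auto simp: s'_def)
  finally have "(\<Sum>j\<le>n. s' j) = 1" by (simp add: s'_def)
  moreover have "(\<Sum>j\<le>n. s' j) \<le> 0"
  proof (rule maximum_point_lower_right_slopes[OF max])
    show "lower_right_slope (\<kappa> j) (c - ynode n y j) (s' j)" if "j \<le> n" for j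
      using s[OF that] unbounded by (cases "j = i") (simp_all add: s'_def)
  qed
  ultimately show False by simp
qed

lemma maximum_point_bounded_left_slope:
  assumes max: "maximum_point y c" and i: "i \<le> n"
  shows "\<exists>s. \<not> lower_left_slope (\<kappa> i) (c - ynode n y i) s"
proof -
  interpret reflected: kernel_system n "\<lambda>j t. K j (- t)" by (rule kernel_system_reflect)
  have point: "- (c - ynode n y i) = - c - ynode n (\<lambda>j. - y j) i" using i by (simp add: ynode_def)
  show ?thesis
    unfolding point
    using maximum_point_reflect[OF max] i by (rule reflected.maximum_point_bounded_right_slope)
qed

lemma maximum_point_not_at_infinite_slope:
  assumes max: "maximum_point y c" and i: "i \<le> n" "cond_infty' (K i)"
  shows "c - ynode n y i \<noteq> 2 * pi * of_int m"
proof
  assume node: "c - ynode n y i = 2 * pi * of_int m"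
  then have "K i 0 \<noteq> -\<infinity>"
    using maximum_point_kernel_finite[OF max i(1)] kernel_periodic[OF kernel[OF i(1)], of 0 m]
    by auto
  then show False
    using kernel_infinite_slope[OF kernel[OF i(1)] i(2), of m]
      maximum_point_bounded_right_slope[OF max i(1)] maximum_point_bounded_left_slope[OF max i(1)]
    unfolding node by blast
qed

lemma maximum_point_not_at_kink:
  assumes max: "maximum_point y c" and i: "i \<le> n" and C1: "\<And>j. j \<le> n \<Longrightarrow> C1_kernel (K j)"
  shows "c - ynode n y i \<noteq> 2 * pi * of_int m"
proof
  assume node: "c - ynode n y i = 2 * pi * of_int m"
  define opposite where "opposite j s s' \<longleftrightarrow> lower_right_slope (\<kappa> j) (c - ynode n y j) s \<and>
    lower_left_slope (\<kappa> j) (c - ynode n y j) s'" for j s s'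
  have finite: "\<bar>K j (c - ynode n y j)\<bar> \<noteq> \<infinity>" if "j \<le> n" for j
    using max that by (rule maximum_point_kernel_finite)
  then have "K i 0 \<noteq> -\<infinity>" using finite[OF i] node kernel_periodic[OF kernel[OF i], of 0 m] by auto
  then obtain \<eta> where \<eta>: "0 < \<eta>" "opposite i \<eta> \<eta>"
    unfolding opposite_def node by (rule kernel_convex_kink[OF kernel[OF i]]) blast
  define \<epsilon> where "\<epsilon> = \<eta> / (n + 1)"
  have \<epsilon>: "0 < \<epsilon>" "(n + 1) * \<epsilon> = \<eta>" using \<eta>(1) by (simp_all add: \<epsilon>_def)
  have "\<exists>s s'. opposite j s s' \<and> (if j = i then \<eta> else - \<epsilon>) \<le> s + s'" if "j \<le> n" for j
  proof (cases "j = i")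
    case True
    then show ?thesis using \<eta> by (intro exI[of _ \<eta>]) simp
  next
    case False
    then show ?thesis
      using C1_kernel_opposite_slopes[OF kernel C1 finite \<epsilon>(1)] that unfolding opposite_def by simp
  qed
  then obtain s s' where s: "\<And>j. j \<le> n \<Longrightarrow> opposite j (s j) (s' j)"
      "\<And>j. j \<le> n \<Longrightarrow> (if j = i then \<eta> else - \<epsilon>) \<le> s j + s' j"
    by metis
  have "0 < \<eta> - n * \<epsilon>" using \<epsilon> by (simp add: algebra_simps)
  also have "\<eta> - n * \<epsilon> = (\<Sum>j\<le>n. if j = i then \<eta> else - \<epsilon>)"
    using i by (simp add: sum.remove[of "{..n}" i])
  also have "\<dots> \<le> (\<Sum>j\<le>n. s j) + (\<Sum>j\<le>n. s' j)"
    unfolding sum.distrib[symmetric] using s(2) by (intro sum_mono) auto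
  also have "\<dots> \<le> 0"
    using s(1) unfolding opposite_def
    by (intro add_nonpos_nonpos maximum_point_lower_right_slopes[OF max]
        maximum_point_lower_left_slopes[OF max]) auto
  finally show False by simp
qed

end

section \<open>Perturbing the nodes\<close>

definition same_cell :: "nat \<Rightarrow> (nat \<Rightarrow> real) \<Rightarrow> real \<Rightarrow> (nat \<Rightarrow> real) \<Rightarrow> real \<Rightarrow> bool" where
  "same_cell n x s y t \<longleftrightarrow>
    (\<forall>j\<le>n. \<exists>l. s - ynode n x j \<in> branch l \<and> t - ynode n y j \<in> branch l)"

lemma tendsto_ynode_perturbed:
  "((\<lambda>p. ynode n (\<lambda>j. w j + fst p * v j) k) \<longlongrightarrow> ynode n w k) (at_right 0 \<times>\<^sub>F G)"
proof -
  have "(fst \<longlongrightarrow> 0) (at_right (0::real) \<times>\<^sub>F G)"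
    by (rule filterlim_mono[OF filterlim_fst at_within_le_nhds order_refl])
  then have "((\<lambda>p. w k + fst p * v k) \<longlongrightarrow> w k + 0 * v k) (at_right 0 \<times>\<^sub>F G)"
    by (intro tendsto_intros)
  then show ?thesis by (simp add: ynode_def)
qed

lemma perturbed_nodes_moved:
  assumes "s \<noteq> 0" "i \<in> {1..n}" "v i \<noteq> 0"
  shows "\<exists>j\<le>n. t - ynode n (\<lambda>j. w j + s * v j) j \<noteq> z - ynode n w j"
proof (cases "t = z")
  case True
  then show ?thesis using assms by (intro exI[of _ i]) (simp add: ynode_def)
next
  case False
  then show ?thesis by (intro exI[of _ 0]) (simp add: ynode_def)
qed

lemma eventually_same_cell:
  assumes cell: "same_cell n w z w z"
    and "\<And>j. j \<le> n \<Longrightarrow> ((\<lambda>p. ynode n (Y p) j) \<longlongrightarrow> ynode n w j) G" and T: "(T \<longlongrightarrow> z) G"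
  shows "\<forall>\<^sub>F p in G. same_cell n w z (Y p) (T p)"
proof -
  have "\<forall>\<^sub>F p in G. \<exists>l. z - ynode n w j \<in> branch l \<and> T p - ynode n (Y p) j \<in> branch l"
    if j: "j \<in> {..n}" for j
  proof -
    obtain l where l: "z - ynode n w j \<in> branch l" using cell j by (auto simp: same_cell_def)
    have "((\<lambda>p. T p - ynode n (Y p) j) \<longlongrightarrow> z - ynode n w j) G"
      using assms(2) j by (intro tendsto_diff T) simp
    from topological_tendstoD[OF this open_branch l] show ?thesis
      by eventually_elim (use l in blast)
  qed
  then have "\<forall>\<^sub>F p in G. \<forall>j\<in>{..n}. \<exists>l. z - ynode n w j \<in> branch l \<and>
      T p - ynode n (Y p) j \<in> branch l"
    by (intro eventually_ball_finite ballI) simp_all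
  then show ?thesis by eventually_elim (simp add: same_cell_def)
qed

context kernel_system
begin

lemma same_cell_F_eq_real:
  assumes "same_cell n x s y t"
  shows "F x s = ereal (\<Sum>j\<le>n. \<kappa> j (s - ynode n x j))"
    and "F y t = ereal (\<Sum>j\<le>n. \<kappa> j (t - ynode n y j))"
proof -
  have "\<bar>K j (s - ynode n x j)\<bar> \<noteq> \<infinity> \<and> \<bar>K j (t - ynode n y j)\<bar> \<noteq> \<infinity>" if j: "j \<le> n" for j
  proof -
    obtain l where "s - ynode n x j \<in> branch l" "t - ynode n y j \<in> branch l"
      using assms j unfolding same_cell_def by blast
    then show ?thesis by (intro conjI kernel_finite[OF kernel[OF j]])
  qed
  then show "F x s = ereal (\<Sum>j\<le>n. \<kappa> j (s - ynode n x j))"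
    "F y t = ereal (\<Sum>j\<le>n. \<kappa> j (t - ynode n y j))"
    by (simp_all add: F_eq_real)
qed

lemma F_concave_on_cells:
  assumes cell: "same_cell n x s y t" and uv: "0 \<le> u" "0 \<le> v" "u + v = 1"
    and bounds: "ereal a \<le> F x s" "ereal b \<le> F y t"
  shows "ereal (u * a + v * b) \<le> F (\<lambda>j. u * x j + v * y j) (u * s + v * t)"
proof -
  define p q where "p j = s - ynode n x j" and "q j = t - ynode n y j" for j
  have argument: "u * s + v * t - ynode n (\<lambda>j. u * x j + v * y j) j = u * p j + v * q j" for j
    by (simp add: p_def q_def ynode_affine_combination[OF uv(3)] algebra_simps)
  have finite: "\<bar>K j (u * p j + v * q j)\<bar> \<noteq> \<infinity>"
    and concave: "u * \<kappa> j (p j) + v * \<kappa> j (q j) \<le> \<kappa> j (u * p j + v * q j)"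
    if j: "j \<le> n" for j
  proof -
    obtain l where l: "p j \<in> branch l" "q j \<in> branch l"
      using cell j unfolding same_cell_def p_def q_def by blast
    have "u * p j + v * q j \<in> branch l" using convexD[OF convex_branch l uv] by simp
    then show "\<bar>K j (u * p j + v * q j)\<bar> \<noteq> \<infinity>" by (rule kernel_finite[OF kernel[OF j]])
    have "u * \<kappa> j (p j) + v * \<kappa> j (q j) \<le> \<kappa> j (u *\<^sub>R p j + v *\<^sub>R q j)"
      using kernel_concave[OF kernel[OF j], of l] l uv unfolding concave_on_iff by blast
    then show "u * \<kappa> j (p j) + v * \<kappa> j (q j) \<le> \<kappa> j (u * p j + v * q j)"
      by simp
  qed
  have "u * a + v * b \<le> u * (\<Sum>j\<le>n. \<kappa> j (p j)) + v * (\<Sum>j\<le>n. \<kappa> j (q j))"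
    using bounds uv same_cell_F_eq_real[OF cell]
    by (intro add_mono mult_left_mono) (simp_all add: p_def q_def)
  also have "\<dots> \<le> (\<Sum>j\<le>n. \<kappa> j (u * p j + v * q j))"
    unfolding sum_distrib_left sum.distrib[symmetric] using concave by (intro sum_mono) simp
  also have "ereal \<dots> = F (\<lambda>j. u * x j + v * y j) (u * s + v * t)"
    using finite by (subst F_eq_real) (simp_all add: argument)
  finally show ?thesis by simp
qed

lemma maximum_point_sum_Dplus:
  assumes max: "maximum_point w z" and cell: "same_cell n w z w z"
  shows "(\<Sum>j\<le>n. Dplus (\<kappa> j) (z - ynode n w j)) \<le> 0"
proof (rule sum_le_of_less)
  fix s assume less: "\<And>j. j \<in> {..n} \<Longrightarrow> s j < Dplus (\<kappa> j) (z - ynode n w j)"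
  show "(\<Sum>j\<le>n. s j) \<le> 0"
  proof (rule maximum_point_lower_right_slopes[OF max])
    fix j assume j: "j \<le> n"
    obtain l where "z - ynode n w j \<in> branch l" using cell j by (auto simp: same_cell_def)
    then have "z - ynode n w j \<in> interior (branch l)" by (simp add: interior_open open_branch)
    then show "lower_right_slope (\<kappa> j) (z - ynode n w j) (s j)"
      using less[of j] j
      by (intro lower_right_slope_less_Dplus[OF kernel_concave[OF kernel[OF j]]]) simp_all
  qed
qed

lemma maximum_point_sum_Dminus:
  assumes max: "maximum_point w z" and cell: "same_cell n w z w z"
  shows "0 \<le> (\<Sum>j\<le>n. Dminus (\<kappa> j) (z - ynode n w j))"
proof -
  have "(\<Sum>j\<le>n. - Dminus (\<kappa> j) (z - ynode n w j)) \<le> 0"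
  proof (rule sum_le_of_less)
    fix s assume less: "\<And>j. j \<in> {..n} \<Longrightarrow> s j < - Dminus (\<kappa> j) (z - ynode n w j)"
    show "(\<Sum>j\<le>n. s j) \<le> 0"
    proof (rule maximum_point_lower_left_slopes[OF max])
      fix j assume j: "j \<le> n"
      obtain l where "z - ynode n w j \<in> branch l" using cell j by (auto simp: same_cell_def)
      then have l: "z - ynode n w j \<in> interior (branch l)" by (simp add: interior_open open_branch)
      note concave = kernel_concave[OF kernel[OF j], of l]
      show "lower_left_slope (\<kappa> j) (z - ynode n w j) (s j)"
      proof (rule lower_right_slope_less_Dplus[OF concave_on_reflect[OF concave]])
        show "- (z - ynode n w j) \<in> interior (uminus ` branch l)"
          unfolding interior_negations using l by (rule imageI)
        show "s j < Dplus (real_kernel (\<lambda>t. K j (- t))) (- (z - ynode n w j))"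
          using less[of j] j unfolding Dminus_eq_Dplus_reflect[OF concave l] by simp
      qed
    qed
  qed
  then show ?thesis by (simp add: sum_negf)
qed

lemma maximum_point_balanced_slopes:
  assumes max: "maximum_point w z" and cell: "same_cell n w z w z"
  shows "\<exists>a. (\<forall>j\<in>{..n}. Dplus (\<kappa> j) (z - ynode n w j) \<le> a j \<and> a j \<le> Dminus (\<kappa> j) (z - ynode n w j))
    \<and> (\<Sum>j\<le>n. a j) = 0"
proof (rule exists_sum_eq_between)
  fix j assume "j \<in> {..n}"
  moreover from this obtain l where "z - ynode n w j \<in> interior (branch l)"
    using cell by (auto simp: same_cell_def interior_open open_branch)
  ultimately show "Dplus (\<kappa> j) (z - ynode n w j) \<le> Dminus (\<kappa> j) (z - ynode n w j)"
    by (intro Dplus_le_Dminus[OF kernel_concave[OF kernel]]) auto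
qed (use maximum_point_sum_Dplus[OF max cell] maximum_point_sum_Dminus[OF max cell] in simp_all)

text \<open>As the slopes \<open>a j\<close> sum to zero, the displacement \<open>t - z\<close> does not appear.\<close>
lemma maximum_point_supergradient:
  assumes max: "maximum_point w z" and cell: "same_cell n w z w z"
  shows "\<exists>a. \<forall>y t. same_cell n w z y t \<longrightarrow> (\<exists>j\<le>n. t - ynode n y j \<noteq> z - ynode n w j) \<longrightarrow>
    F y t < F w z + ereal (\<Sum>j\<in>{1..n}. a j * (w j - y j))"
proof -
  define p where "p j = z - ynode n w j" for j
  obtain a
    where slopes: "\<And>j. j \<le> n \<Longrightarrow> Dplus (\<kappa> j) (p j) \<le> a j" "\<And>j. j \<le> n \<Longrightarrow> a j \<le> Dminus (\<kappa> j) (p j)"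
    and balanced: "(\<Sum>j\<le>n. a j) = 0"
    using maximum_point_balanced_slopes[OF max cell] unfolding p_def by auto
  have "F y t < F w z + ereal (\<Sum>j\<in>{1..n}. a j * (w j - y j))"
    if cell: "same_cell n w z y t" and moved: "\<exists>j\<le>n. t - ynode n y j \<noteq> p j" for y t
  proof -
    define q where "q j = t - ynode n y j" for j
    have below_tangent: "\<kappa> j (q j) < \<kappa> j (p j) + a j * (q j - p j)" if j: "j \<le> n" "q j \<noteq> p j" for j
    proof -
      obtain l where "p j \<in> interior (branch l)" "q j \<in> branch l"
        using cell j(1) by (auto simp: same_cell_def p_def q_def interior_open open_branch)
      then show ?thesis
        using kernel_strictly_concave[OF kernel[OF j(1)]] j(2) slopes[OF j(1)]
        by (intro strictly_concave_on_less_tangent)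
    qed
    then have "\<kappa> j (q j) \<le> \<kappa> j (p j) + a j * (q j - p j)" if "j \<le> n" for j
      using that by (cases "q j = p j") (auto simp: less_imp_le)
    then have "(\<Sum>j\<le>n. \<kappa> j (q j)) < (\<Sum>j\<le>n. \<kappa> j (p j) + a j * (q j - p j))"
      using moved below_tangent by (intro sum_strict_mono_ex1) (auto simp: q_def)
    also have "\<dots> = (\<Sum>j\<le>n. \<kappa> j (p j) + a j * (t - z) + a j * (ynode n w j - ynode n y j))"
      by (rule sum.cong) (simp_all add: p_def q_def algebra_simps)
    also have "\<dots> = (\<Sum>j\<le>n. \<kappa> j (p j)) + (\<Sum>j\<le>n. a j * (ynode n w j - ynode n y j))"
      using balanced by (simp add: sum.distrib sum_distrib_right[symmetric])
    also have "(\<Sum>j\<le>n. a j * (ynode n w j - ynode n y j)) = (\<Sum>j\<in>{1..n}. a j * (w j - y j))"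
      by (rule sum.mono_neutral_cong_right) (auto simp: ynode_def)
    finally show ?thesis
      using same_cell_F_eq_real[OF cell] by (simp add: p_def q_def)
  qed
  then show ?thesis unfolding p_def by blast
qed

definition descent_direction :: "(nat \<Rightarrow> real) \<Rightarrow> real \<Rightarrow> (nat \<Rightarrow> real) \<Rightarrow> bool" where
  "descent_direction w z v \<longleftrightarrow>
    (\<forall>\<^sub>F p in at_right 0 \<times>\<^sub>F nhds z. F (\<lambda>j. w j + fst p * v j) (snd p) < F w z)"

lemma maximum_point_descent_directions:
  assumes "maximum_point w z" and cell: "same_cell n w z w z"
  shows "\<exists>a. \<forall>v. (\<exists>j\<in>{1..n}. v j \<noteq> 0) \<longrightarrow> 0 \<le> (\<Sum>j\<in>{1..n}. a j * v j) \<longrightarrow>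
    descent_direction w z v"
proof -
  obtain a where a: "same_cell n w z y t \<Longrightarrow> (\<exists>j\<le>n. t - ynode n y j \<noteq> z - ynode n w j) \<Longrightarrow>
    F y t < F w z + ereal (\<Sum>j\<in>{1..n}. a j * (w j - y j))" for y t
    using maximum_point_supergradient[OF assms] by blast
  show ?thesis
  proof (intro exI[of _ a] allI impI)
    fix v :: "nat \<Rightarrow> real"
    assume v: "\<exists>j\<in>{1..n}. v j \<noteq> 0" "0 \<le> (\<Sum>j\<in>{1..n}. a j * v j)"
    let ?G = "at_right (0::real) \<times>\<^sub>F nhds z"
    define Y where "Y s = (\<lambda>j. w j + s * v j)" for s :: real
    have "\<forall>\<^sub>F p in ?G. same_cell n w z (Y (fst p)) (snd p)"
      unfolding Y_def by (intro eventually_same_cell[OF cell] tendsto_ynode_perturbed filterlim_snd)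
    moreover have "\<forall>\<^sub>F p in ?G. 0 < fst p"
      by (rule eventually_compose_filterlim[OF eventually_at_right_less filterlim_fst])
    ultimately show "descent_direction w z v" unfolding descent_direction_def
    proof eventually_elim
      case (elim p)
      have "\<exists>j\<le>n. snd p - ynode n (Y (fst p)) j \<noteq> z - ynode n w j"
        unfolding Y_def using v(1) elim(2) perturbed_nodes_moved by fastforce
      from a[OF elim(1) this]
      have "F (Y (fst p)) (snd p) < F w z + ereal (\<Sum>j\<in>{1..n}. a j * (w j - Y (fst p) j))" .
      also have "(\<Sum>j\<in>{1..n}. a j * (w j - Y (fst p) j)) = - (fst p * (\<Sum>j\<in>{1..n}. a j * v j))"
        by (simp add: Y_def sum_distrib_left sum_negf[symmetric] algebra_simps)
      also have "F w z + ereal \<dots> \<le> F w z + 0"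
        using v(2) elim(2) by (intro add_left_mono) simp
      finally show ?case by (simp add: Y_def)
    qed
  qed
qed

lemma few_maximum_points_improvable:
  assumes "1 \<le> n" and cell: "\<And>z. maximum_point w z \<Longrightarrow> same_cell n w z w z"
    and few: "finite (maximum_points w)" "card (maximum_points w) \<le> n"
  shows "\<exists>y. circle_sup y < circle_sup w"
proof -
  have "\<forall>z\<in>maximum_points w. \<exists>a. \<forall>v. (\<exists>j\<in>{1..n}. v j \<noteq> 0) \<longrightarrow> 0 \<le> (\<Sum>j\<in>{1..n}. a j * v j)
      \<longrightarrow> descent_direction w z v"
    using maximum_point_descent_directions cell by (simp add: maximum_points_def)
  then obtain a where a: "\<forall>z\<in>maximum_points w. \<forall>v. (\<exists>j\<in>{1..n}. v j \<noteq> 0) \<longrightarrow>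
      0 \<le> (\<Sum>j\<in>{1..n}. a z j * v j) \<longrightarrow> descent_direction w z v"
    unfolding bchoice_iff by blast
  obtain v where v: "\<exists>j\<in>{1..n}. v j \<noteq> 0" "\<forall>z\<in>maximum_points w. 0 \<le> (\<Sum>j\<in>{1..n}. a z j * v j)"
    using homogeneous_inequalities_solution[of "maximum_points w" "{1..n}" a] few \<open>1 \<le> n\<close> by auto
  have "\<forall>\<^sub>F p in at_right 0 \<times>\<^sub>F nhds z. F (\<lambda>j. w j + fst p * v j) (snd p) < circle_sup w"
    if "z \<in> {0..2*pi}" for z
  proof (cases "maximum_point w z")
    case True
    then have "descent_direction w z v" using a v that by (simp add: maximum_points_def)
    then show ?thesis using True by (simp add: descent_direction_def maximum_point_iff)
  next
    case False
    have "((\<lambda>p. F (\<lambda>j. w j + fst p * v j) (snd p)) \<longlongrightarrow> F w z) (at_right 0 \<times>\<^sub>F nhds z)"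
      by (intro F_tendsto tendsto_ynode_perturbed filterlim_snd)
    moreover have "F w z < circle_sup w"
      using False F_le_circle_sup[of w z] by (simp add: maximum_point_iff less_le)
    ultimately show ?thesis by (rule order_tendstoD)
  qed
  then have "\<forall>\<^sub>F s in at_right 0. \<forall>t\<in>{0..2*pi}. F (\<lambda>j. w j + s * v j) t < circle_sup w"
    using eventually_ball_compact[OF compact_Icc, of 0 "2*pi"
      "\<lambda>p. F (\<lambda>j. w j + fst p * v j) (snd p) < circle_sup w" "at_right 0"] by simp
  then obtain s where s: "\<And>t. t \<in> {0..2*pi} \<Longrightarrow> F (\<lambda>j. w j + s * v j) t < circle_sup w"
    using eventually_happens'[OF trivial_limit_at_right_real] by blast
  obtain c where "c \<in> {0..<2*pi}" "maximum_point (\<lambda>j. w j + s * v j) c"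
    by (rule maximum_point_exists)
  then have "circle_sup (\<lambda>j. w j + s * v j) < circle_sup w"
    using s[of c] by (simp add: maximum_point_iff)
  then show ?thesis by blast
qed

end

section \<open>Simplices\<close>

definition open_arc :: "nat \<Rightarrow> (nat \<Rightarrow> nat) \<Rightarrow> (nat \<Rightarrow> real) \<Rightarrow> nat \<Rightarrow> real set" where
  "open_arc n \<sigma> y k = {ynode n y (\<sigma> k)<..<ynode n y (\<sigma> (k + 1))}"

abbreviation weakly_ordered :: "nat \<Rightarrow> (nat \<Rightarrow> nat) \<Rightarrow> (nat \<Rightarrow> real) \<Rightarrow> bool" where
  "weakly_ordered n \<sigma> y \<equiv> mono_on {0..n + 1} (\<lambda>k. ynode n y (\<sigma> k))"

abbreviation strictly_ordered :: "nat \<Rightarrow> (nat \<Rightarrow> nat) \<Rightarrow> (nat \<Rightarrow> real) \<Rightarrow> bool" where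
  "strictly_ordered n \<sigma> y \<equiv> strict_mono_on {0..n + 1} (\<lambda>k. ynode n y (\<sigma> k))"

lemma permutes_fixes_ends:
  fixes n :: nat
  assumes "\<sigma> permutes {1..n}"
  shows "\<sigma> 0 = 0" "\<sigma> (n + 1) = n + 1"
  using permutes_not_in[OF assms, of 0] permutes_not_in[OF assms, of "n + 1"] by auto

lemma permutes_le:
  fixes n :: nat
  assumes "\<sigma> permutes {1..n}" "k \<le> m" "n \<le> m"
  shows "\<sigma> k \<le> m"
  using permutes_in_image[OF assms(1), of k] permutes_not_in[OF assms(1), of k] assms(2,3)
  by (cases "k \<in> {1..n}") auto

lemma Ssimplex_iff: "y \<in> Ssimplex n \<sigma> \<longleftrightarrow> y \<in> nodes n \<and> strictly_ordered n \<sigma> y"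
proof -
  have "(\<forall>k\<in>{0..n}. ynode n y (\<sigma> k) < ynode n y (\<sigma> (k + 1))) \<longleftrightarrow> strictly_ordered n \<sigma> y"
    using strict_mono_on_Icc_SucI[of 0 "n + 1" "\<lambda>k. ynode n y (\<sigma> k)"]
    by (auto intro: strict_mono_onD)
  then show ?thesis by (simp add: Ssimplex_def)
qed

lemma ynode_range:
  assumes "y \<in> nodes n" "j \<le> n + 1"
  shows "0 \<le> ynode n y j" "ynode n y j \<le> 2*pi"
proof -
  have "j = 0 \<or> j = n + 1 \<or> y j \<in> {0..<2*pi}"
    using assms PiE_mem[of y "{1..n}" "\<lambda>_. {0..<2*pi}" j] by (auto simp: nodes_def)
  then show "0 \<le> ynode n y j" "ynode n y j \<le> 2*pi" by (auto simp: ynode_def)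
qed

lemma nodes_sortable:
  assumes "y \<in> nodes n"
  shows "\<exists>\<sigma>. \<sigma> permutes {1..n} \<and> weakly_ordered n \<sigma> y"
proof -
  obtain \<sigma> where \<sigma>: "\<sigma> permutes {1..n}" and mono: "mono_on {1..n} (y \<circ> \<sigma>)"
    using sorting_permutation by blast
  have "ynode n y (\<sigma> k) \<le> ynode n y (\<sigma> (k + 1))" if k: "k \<le> n" for k
  proof -
    have indices: "\<sigma> k \<le> n + 1" "\<sigma> (k + 1) \<le> n + 1"
      using k by (auto intro!: permutes_le[OF \<sigma>])
    consider (left) "k = 0" | (right) "k = n" | (inner) "k \<in> {1..n}" "k + 1 \<in> {1..n}"
      using k by (cases "k = 0"; cases "k = n") auto
    then show ?thesis
    proof cases
      case left
      then show ?thesis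
        using ynode_range(1)[OF assms indices(2)] permutes_fixes_ends[OF \<sigma>] by (simp add: ynode_def)
    next
      case right
      then show ?thesis
        using ynode_range(2)[OF assms indices(1)] permutes_fixes_ends[OF \<sigma>] by (simp add: ynode_def)
    next
      case inner
      then have "y (\<sigma> k) \<le> y (\<sigma> (k + 1))" using mono_onD[OF mono inner] by simp
      moreover have "\<sigma> k \<in> {1..n}" "\<sigma> (k + 1) \<in> {1..n}"
        using inner by (simp_all only: permutes_in_image[OF \<sigma>])
      ultimately show ?thesis by (simp add: ynode_def)
    qed
  qed
  then have "weakly_ordered n \<sigma> y" by (intro mono_on_Icc_SucI) simp
  then show ?thesis using \<sigma> by blast
qed

lemma arcs_cover:
  assumes \<sigma>: "\<sigma> permutes {1..n}" and t: "t \<in> {0..<2*pi}"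
  obtains k where "k \<le> n" "t \<in> {ynode n y (\<sigma> k)..ynode n y (\<sigma> (k + 1))}"
proof -
  define A where "A = {k. k \<le> n \<and> ynode n y (\<sigma> k) \<le> t}"
  have "0 \<in> A" using t permutes_fixes_ends[OF \<sigma>] by (simp add: A_def ynode_def)
  moreover have finite: "finite A" by (simp add: A_def)
  ultimately have Max: "Max A \<in> A" by (intro Max_in) auto
  have "Max A + 1 \<notin> A" using Max_ge[OF finite, of "Max A + 1"] by auto
  have "t \<le> ynode n y (\<sigma> (Max A + 1))"
  proof (cases "Max A = n")
    case True
    then show ?thesis using t permutes_fixes_ends[OF \<sigma>] by (simp add: ynode_def)
  next
    case False
    then have "Max A + 1 \<le> n" using Max by (simp add: A_def)
    then show ?thesis using \<open>Max A + 1 \<notin> A\<close> by (simp add: A_def)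
  qed
  then show ?thesis using that[of "Max A"] Max by (simp add: A_def)
qed

lemma open_arc_branch:
  assumes \<sigma>: "\<sigma> permutes {1..n}" and mono: "weakly_ordered n \<sigma> y"
    and k: "k \<le> n" and t: "t \<in> open_arc n \<sigma> y k" and i: "i \<le> n"
  shows "t - ynode n y (\<sigma> i) \<in> branch (if i \<le> k then 0 else - 1)"
proof -
  have ordered: "ynode n y (\<sigma> i) \<le> ynode n y (\<sigma> j)" if "i \<le> j" "j \<le> n + 1" for i j
    using mono_onD[OF mono, of i j] that by simp
  have range: "0 \<le> ynode n y (\<sigma> j)" "ynode n y (\<sigma> j) \<le> 2*pi" if "j \<le> n + 1" for j
    using ordered[of 0 j] ordered[of j "n + 1"] that permutes_fixes_ends[OF \<sigma>]
    by (simp_all add: ynode_def)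
  show ?thesis
  proof (cases "i \<le> k")
    case True
    then show ?thesis
      using ordered[of i k] t k range(1)[of i] range(2)[of "k + 1"]
      by (auto simp: branch_0 open_arc_def)
  next
    case False
    then show ?thesis
      using ordered[of "k + 1" i] t i k range(1)[of k] range(2)[of i]
      by (auto simp: branch_minus_1 open_arc_def)
  qed
qed

lemma open_arc_same_cell:
  assumes \<sigma>: "\<sigma> permutes {1..n}" and k: "k \<le> n"
    and "weakly_ordered n \<sigma> x" "s \<in> open_arc n \<sigma> x k"
    and "weakly_ordered n \<sigma> y" "t \<in> open_arc n \<sigma> y k"
  shows "same_cell n x s y t"
  unfolding same_cell_def
proof (intro allI impI)
  fix j assume "j \<le> n"
  then have "inv \<sigma> j \<le> n" by (rule permutes_le[OF permutes_inv[OF \<sigma>]]) simp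
  then have "s - ynode n x (\<sigma> (inv \<sigma> j)) \<in> branch (if inv \<sigma> j \<le> k then 0 else - 1)"
    "t - ynode n y (\<sigma> (inv \<sigma> j)) \<in> branch (if inv \<sigma> j \<le> k then 0 else - 1)"
    using assms by (simp_all only: open_arc_branch)
  then show "\<exists>l. s - ynode n x j \<in> branch l \<and> t - ynode n y j \<in> branch l"
    unfolding permutes_inverses(1)[OF \<sigma>] by blast
qed

lemma strictly_ordered_extrapolate:
  assumes "strictly_ordered n \<sigma> w"
  obtains s where "0 < s" "strictly_ordered n \<sigma> (\<lambda>j. (1 + s) * w j + (- s) * x j)"
proof -
  have "\<forall>\<^sub>F s in at 0. strict_mono_on {0..n + 1}
      (\<lambda>k. ynode n w (\<sigma> k) + s * (ynode n w (\<sigma> k) - ynode n x (\<sigma> k)))"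
    by (rule eventually_strict_mono_on_add_scaled[OF _ assms]) simp
  then have "\<forall>\<^sub>F s in at_right 0. strict_mono_on {0..n + 1}
      (\<lambda>k. ynode n w (\<sigma> k) + s * (ynode n w (\<sigma> k) - ynode n x (\<sigma> k)))"
    by (simp add: eventually_at_split)
  moreover have "\<forall>\<^sub>F s in at_right (0::real). 0 < s" by (rule eventually_at_right_less)
  ultimately have "\<forall>\<^sub>F s in at_right 0. 0 < s \<and>
      strictly_ordered n \<sigma> (\<lambda>j. (1 + s) * w j + (- s) * x j)"
    by eventually_elim (subst ynode_affine_combination; simp add: algebra_simps)
  then show ?thesis
    using eventually_happens'[OF trivial_limit_at_right_real] that by blast
qed

context kernel_system
begin

lemma maximum_point_unique_in_open_arc:
  assumes \<sigma>: "\<sigma> permutes {1..n}" "weakly_ordered n \<sigma> w" and k: "k \<le> n"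
    and z: "z \<in> open_arc n \<sigma> w k" "maximum_point w z"
    and z': "z' \<in> open_arc n \<sigma> w k" "maximum_point w z'"
  shows "z = z'"
proof (rule ccontr)
  assume "z \<noteq> z'"
  have "same_cell n w z w z" "same_cell n w z w z'"
    using assms by (intro open_arc_same_cell[OF \<sigma>(1)]; simp)+
  then obtain a where "F w z' < F w z + ereal (\<Sum>j\<in>{1..n}. a j * (w j - w j))"
    using maximum_point_supergradient[OF z(2)] \<open>z \<noteq> z'\<close> by fastforce
  then show False using z(2) z'(2) by (simp add: maximum_point_iff)
qed

lemma circle_sup_le_mbar:
  assumes \<sigma>: "\<sigma> permutes {1..n}"
  shows "circle_sup y \<le> mbar n K \<sigma> y"
  unfolding circle_sup_def
proof (rule SUP_least)
  fix t :: real assume "t \<in> {0..<2*pi}"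
  then obtain k where k: "k \<le> n" "t \<in> {ynode n y (\<sigma> k)..ynode n y (\<sigma> (k + 1))}"
    by (rule arcs_cover[OF \<sigma>])
  have "F y t \<le> mloc n K \<sigma> y k" unfolding mloc_def using k(2) by (rule SUP_upper)
  also have "\<dots> \<le> mbar n K \<sigma> y" unfolding mbar_def using k(1) by (intro Max_ge) auto
  finally show "F y t \<le> mbar n K \<sigma> y" .
qed

lemma mloc_le_circle_sup: "mloc n K \<sigma> y k \<le> circle_sup y"
  unfolding mloc_def by (rule SUP_least) (rule F_le_circle_sup)

lemma mloc_eq_circle_sup:
  assumes "z \<in> open_arc n \<sigma> y k" "maximum_point y z"
  shows "mloc n K \<sigma> y k = circle_sup y"
proof (rule antisym[OF mloc_le_circle_sup])
  have "F y z \<le> mloc n K \<sigma> y k"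
    unfolding mloc_def using assms(1) by (intro SUP_upper) (simp add: open_arc_def)
  then show "circle_sup y \<le> mloc n K \<sigma> y k" using assms(2) by (simp add: maximum_point_iff)
qed

lemma mloc_eq_SUP_open_arc:
  assumes "strictly_ordered n \<sigma> y" "k \<le> n"
  shows "mloc n K \<sigma> y k = (SUP t\<in>open_arc n \<sigma> y k. F y t)"
proof -
  have "ynode n y (\<sigma> k) < ynode n y (\<sigma> (k + 1))"
    using assms(2) by (intro strict_mono_onD[OF assms(1)]) auto
  then show ?thesis
    using SUP_closure[OF continuous_F, where S = "open_arc n \<sigma> y k"]
    by (simp add: mloc_def open_arc_def)
qed

lemma mloc_concave:
  assumes \<sigma>: "\<sigma> permutes {1..n}" and k: "k \<le> n" and uv: "0 \<le> u" "0 \<le> v" "u + v = 1"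
    and x: "strictly_ordered n \<sigma> x" "ereal a < mloc n K \<sigma> x k"
    and y: "strictly_ordered n \<sigma> y" "ereal b < mloc n K \<sigma> y k"
  shows "ereal (u * a + v * b) \<le> mloc n K \<sigma> (\<lambda>j. u * x j + v * y j) k"
proof -
  obtain s where s: "s \<in> open_arc n \<sigma> x k" "ereal a < F x s"
    using x(2) unfolding mloc_eq_SUP_open_arc[OF x(1) k] less_SUP_iff by blast
  obtain t where t: "t \<in> open_arc n \<sigma> y k" "ereal b < F y t"
    using y(2) unfolding mloc_eq_SUP_open_arc[OF y(1) k] less_SUP_iff by blast
  have "same_cell n x s y t"
    using s t x y by (intro open_arc_same_cell[OF \<sigma> k] strict_mono_on_imp_mono_on)
  then have "ereal (u * a + v * b) \<le> F (\<lambda>j. u * x j + v * y j) (u * s + v * t)"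
    using uv s t by (intro F_concave_on_cells) (simp_all add: less_imp_le)
  also have "\<dots> \<le> mloc n K \<sigma> (\<lambda>j. u * x j + v * y j) k"
    unfolding mloc_def
  proof (rule SUP_upper)
    show "u * s + v * t \<in> {ynode n (\<lambda>j. u * x j + v * y j) (\<sigma> k)..
        ynode n (\<lambda>j. u * x j + v * y j) (\<sigma> (k + 1))}"
      using s(1) t(1) uv unfolding ynode_affine_combination[OF uv(3)] open_arc_def
      by (auto intro!: add_mono mult_left_mono)
  qed
  finally show ?thesis .
qed

definition minimax :: ereal where
  "minimax = (INF y\<in>nodes n. circle_sup y)"

lemma minimax_le_circle_sup: "minimax \<le> circle_sup y"
proof -
  obtain y' where y': "y' \<in> nodes n" "F y' = F y" by (rule F_reduce_nodes)
  then have "minimax \<le> circle_sup y'" unfolding minimax_def by (intro INF_lower)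
  then show ?thesis using y'(2) by (simp add: circle_sup_def)
qed

lemma minimizer_exists:
  obtains w where "w \<in> nodes n" "circle_sup w = minimax"
proof -
  define C where "C = ({1..n} \<rightarrow>\<^sub>E {0..2*pi})"
  have "C = PiE UNIV (\<lambda>j. if j \<in> {1..n} then {0..2*pi} else {undefined})"
    by (auto simp: C_def PiE_iff extensional_def split: if_splits)
  then have "compactin (product_topology (\<lambda>_. euclidean) UNIV) C"
    by (auto simp: compactin_PiE)
  then have "compact C" by (simp add: euclidean_product_topology)
  moreover have "C \<noteq> {}" by (auto simp: C_def PiE_eq_empty_iff)
  ultimately obtain y where y: "y \<in> C" "circle_sup y = (INF y\<in>C. circle_sup y)"
    using INF_SUP_attained_compact[of C "{0..<2*pi}" F] continuous_F_nodes
    unfolding circle_sup_def by auto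
  obtain w where w: "w \<in> nodes n" "F w = F y" by (rule F_reduce_nodes)
  have "nodes n \<subseteq> C" unfolding nodes_def C_def by (intro PiE_mono) auto
  then have "circle_sup y \<le> minimax" unfolding y(2) minimax_def by (rule INF_superset_mono) simp
  then have "circle_sup w = minimax"
    using w(2) minimax_le_circle_sup[of w] by (simp add: circle_sup_def antisym)
  then show ?thesis using that w(1) by blast
qed

lemma minimax_finite: "\<bar>minimax\<bar> \<noteq> \<infinity>"
proof -
  obtain w where "circle_sup w = minimax" using minimizer_exists by blast
  moreover obtain z where z: "maximum_point w z" using maximum_point_exists by blast
  moreover have "F w z = ereal (\<Sum>j\<le>n. \<kappa> j (z - ynode n w j))"
    by (intro F_eq_real maximum_point_kernel_finite[OF z])
  ultimately have "minimax = ereal (\<Sum>j\<le>n. \<kappa> j (z - ynode n w j))" by (simp add: maximum_point_iff)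
  then show ?thesis by simp
qed

lemma munder_le_minimax:
  assumes \<sigma>: "\<sigma> permutes {1..n}" and w: "w \<in> Ssimplex n \<sigma>" "circle_sup w = minimax"
    and x: "x \<in> Ssimplex n \<sigma>"
  shows "munder n K \<sigma> x \<le> minimax"
proof (rule ccontr)
  assume "\<not> ?thesis"
  then have above: "minimax < mloc n K \<sigma> x k" if "k \<le> n" for k
    using that by (simp add: munder_def not_le)
  obtain M where M: "minimax = ereal M" using minimax_finite by auto
  obtain s where s: "0 < s" "strictly_ordered n \<sigma> (\<lambda>j. (1 + s) * w j + (- s) * x j)"
    using strictly_ordered_extrapolate w(1) unfolding Ssimplex_iff by blast
  define y where "y = (\<lambda>j. (1 + s) * w j + (- s) * x j)"
  have "mbar n K \<sigma> y \<in> mloc n K \<sigma> y ` {0..n}" unfolding mbar_def by (intro Max_in) auto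
  then obtain k where k: "k \<le> n" "mbar n K \<sigma> y = mloc n K \<sigma> y k" by auto
  then have M_le: "ereal M \<le> mloc n K \<sigma> y k"
    using minimax_le_circle_sup circle_sup_le_mbar[OF \<sigma>] M by (metis order_trans)
  obtain \<beta> where \<beta>: "ereal M < ereal \<beta>" "ereal \<beta> < mloc n K \<sigma> x k"
    using ereal_dense2 above[OF k(1)] unfolding M by blast
  define \<alpha> where "\<alpha> = M - s * (\<beta> - M) / 2"
  have "ereal \<alpha> < ereal M" using s(1) \<beta>(1) by (simp add: \<alpha>_def)
  then have \<alpha>: "ereal \<alpha> < mloc n K \<sigma> y k" using M_le by (rule less_le_trans)
  define u where "u = 1 / (1 + s)"
  have u: "0 \<le> u" "0 \<le> s * u" "u + s * u = 1" using s(1) by (simp_all add: u_def field_simps)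
  have "(\<lambda>j. u * y j + (s * u) * x j) = w"
  proof
    fix j
    have "u * y j + (s * u) * x j = (u + s * u) * w j" by (simp add: y_def algebra_simps)
    then show "u * y j + (s * u) * x j = w j" using u(3) by simp
  qed
  moreover have "ereal (u * \<alpha> + (s * u) * \<beta>) \<le> mloc n K \<sigma> (\<lambda>j. u * y j + (s * u) * x j) k"
    using s(2) x \<alpha> \<beta>(2) unfolding Ssimplex_iff y_def[symmetric]
    by (intro mloc_concave[OF \<sigma> k(1) u]) blast+
  moreover have "mloc n K \<sigma> w k \<le> ereal M" using mloc_le_circle_sup[of \<sigma> w k] w(2) M by simp
  ultimately have "u * \<alpha> + (s * u) * \<beta> \<le> M" by (metis ereal_less_eq(3) order_trans)
  moreover have "u * \<alpha> + (s * u) * \<beta> = (u + s * u) * M + u * s * (\<beta> - M) / 2"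
    by (simp add: \<alpha>_def field_simps)
  moreover have "0 < u * s * (\<beta> - M) / 2" using s(1) \<beta>(1) by (simp add: u_def)
  ultimately show False using u(3) by simp
qed

end

section \<open>The minimizer equioscillates\<close>

locale regular_kernel_system = kernel_system +
  assumes n_pos: "1 \<le> n"
    and regular: "(\<forall>j\<le>n. cond_infty' (K j)) \<or> (\<forall>j\<le>n. C1_kernel (K j))"
begin

lemma maximum_point_not_at_node:
  assumes "maximum_point y c" "i \<le> n"
  shows "c - ynode n y i \<noteq> 2 * pi * of_int m"
  using regular assms(2)
    maximum_point_not_at_infinite_slope[OF assms] maximum_point_not_at_kink[OF assms]
  by blast

lemma maximum_point_same_cell:
  assumes "maximum_point y c"
  shows "same_cell n y c y c"
  unfolding same_cell_def using maximum_point_not_at_node[OF assms] branch_cases by metis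

lemma maximum_point_in_open_arc:
  assumes max: "maximum_point w z" and z: "z \<in> {0..2*pi}" and \<sigma>: "\<sigma> permutes {1..n}"
  shows "\<exists>k\<le>n. z \<in> open_arc n \<sigma> w k"
proof -
  have "z \<noteq> 2*pi" using maximum_point_not_at_node[OF max, of 0 1] by (simp add: ynode_def)
  then obtain k where k: "k \<le> n" "z \<in> {ynode n w (\<sigma> k)..ynode n w (\<sigma> (k + 1))}"
    using arcs_cover[OF \<sigma>, of z w] z by auto
  have not_node: "z \<noteq> ynode n w j" if "j \<le> n + 1" for j
  proof (cases "j = n + 1")
    case True
    then show ?thesis using \<open>z \<noteq> 2*pi\<close> by (simp add: ynode_def)
  next
    case False
    then show ?thesis using maximum_point_not_at_node[OF max, of j 0] that by simp
  qed
  have "\<sigma> k \<le> n + 1" "\<sigma> (k + 1) \<le> n + 1"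
    using k(1) by (auto intro!: permutes_le[OF \<sigma>])
  then have "z \<noteq> ynode n w (\<sigma> k)" "z \<noteq> ynode n w (\<sigma> (k + 1))" using not_node by blast+
  then have "z \<in> open_arc n \<sigma> w k" using k(2) by (simp add: open_arc_def)
  then show ?thesis using k(1) by blast
qed

lemma minimizer_maximum_point_in_every_open_arc:
  assumes min: "circle_sup w = minimax" and \<sigma>: "\<sigma> permutes {1..n}" "weakly_ordered n \<sigma> w"
    and k: "k \<le> n"
  shows "\<exists>z\<in>open_arc n \<sigma> w k. maximum_point w z"
proof (rule ccontr)
  assume empty: "\<not> ?thesis"
  have "\<forall>z\<in>maximum_points w. \<exists>i. i \<le> n \<and> z \<in> open_arc n \<sigma> w i"
    using maximum_point_in_open_arc[OF _ _ \<sigma>(1)] by (simp add: maximum_points_def)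
  then obtain arc where arc: "\<And>z. z \<in> maximum_points w \<Longrightarrow> arc z \<le> n"
      "\<And>z. z \<in> maximum_points w \<Longrightarrow> z \<in> open_arc n \<sigma> w (arc z)"
    by metis
  have inj: "inj_on arc (maximum_points w)"
  proof (rule inj_onI)
    fix z z' assume z: "z \<in> maximum_points w" "z' \<in> maximum_points w" "arc z = arc z'"
    show "z = z'"
      using maximum_point_unique_in_open_arc[OF \<sigma> arc(1)[OF z(1)]] arc(2)[OF z(1)] arc(2)[OF z(2)] z
      by (simp add: maximum_points_def)
  qed
  have arcs: "arc ` maximum_points w \<subseteq> {..n} - {k}"
    using arc empty by (fastforce simp: maximum_points_def)
  have "card (maximum_points w) \<le> card ({..n} - {k})" using inj arcs by (intro card_inj_on_le) auto
  then have "card (maximum_points w) \<le> n" using k by simp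
  moreover have "finite (maximum_points w)" using inj_on_finite[OF inj arcs] by simp
  ultimately obtain y where "circle_sup y < circle_sup w"
    using few_maximum_points_improvable[OF n_pos maximum_point_same_cell] by blast
  then show False using minimax_le_circle_sup[of y] min by simp
qed

lemma minimizer_in_simplex:
  assumes w: "w \<in> nodes n" "circle_sup w = minimax"
  obtains \<sigma> where "\<sigma> permutes {1..n}" "w \<in> Ssimplex n \<sigma>" "\<And>k. k \<le> n \<Longrightarrow> mloc n K \<sigma> w k = minimax"
proof -
  obtain \<sigma> where \<sigma>: "\<sigma> permutes {1..n}" "weakly_ordered n \<sigma> w"
    using nodes_sortable[OF w(1)] by blast
  note peaks = minimizer_maximum_point_in_every_open_arc[OF w(2) \<sigma>]
  have "ynode n w (\<sigma> k) < ynode n w (\<sigma> (k + 1))" if "k \<le> n" for k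
    using peaks[OF that] by (auto simp: open_arc_def)
  then have "w \<in> Ssimplex n \<sigma>" using w(1) by (simp add: Ssimplex_def)
  moreover have "mloc n K \<sigma> w k = minimax" if "k \<le> n" for k
    using peaks[OF that] mloc_eq_circle_sup unfolding w(2)[symmetric] by blast
  ultimately show ?thesis using that \<sigma>(1) by blast
qed

end

theorem theorem11p1:
  fixes n :: nat and K :: "nat \<Rightarrow> real \<Rightarrow> ereal"
  assumes "n \<ge> 1"
    and "\<forall>j\<in>{0..n}. strictly_concave_kernel (K j)"
    and "(\<forall>j\<in>{0..n}. cond_infty' (K j)) \<or> (\<forall>j\<in>{0..n}. C1_kernel (K j))"
  shows "\<exists>w\<in>nodes n.
     (INF y\<in>nodes n. SUP t\<in>{0..<2*pi}. Fsum n K y t) = (SUP t\<in>{0..<2*pi}. Fsum n K w t)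
   \<and> (\<exists>\<sigma>. \<sigma> permutes {1..n} \<and> w \<in> Ssimplex n \<sigma>
       \<and> equioscillation n K \<sigma> w
       \<and> (INF y\<in>Ssimplex n \<sigma>. mbar n K \<sigma> y) = (INF y\<in>nodes n. SUP t\<in>{0..<2*pi}. Fsum n K y t)
       \<and> (SUP y\<in>Ssimplex n \<sigma>. munder n K \<sigma> y) = (INF y\<in>nodes n. SUP t\<in>{0..<2*pi}. Fsum n K y t)
       \<and> (\<forall>x\<in>Ssimplex n \<sigma>. \<forall>y\<in>Ssimplex n \<sigma>.
            munder n K \<sigma> x \<le> (INF y\<in>nodes n. SUP t\<in>{0..<2*pi}. Fsum n K y t)
          \<and> (INF y\<in>nodes n. SUP t\<in>{0..<2*pi}. Fsum n K y t) \<le> mbar n K \<sigma> y))"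
proof -
  interpret regular_kernel_system n K using assms by unfold_locales auto
  obtain w where w: "w \<in> nodes n" "circle_sup w = minimax" by (rule minimizer_exists)
  obtain \<sigma> where \<sigma>: "\<sigma> permutes {1..n}" and simplex: "w \<in> Ssimplex n \<sigma>"
    and mloc: "\<And>k. k \<le> n \<Longrightarrow> mloc n K \<sigma> w k = minimax"
    using minimizer_in_simplex[OF w] by blast
  have "mloc n K \<sigma> w ` {0..n} = {minimax}" using mloc by force
  then have attained: "mbar n K \<sigma> w = minimax" "munder n K \<sigma> w = minimax"
    by (simp_all add: mbar_def munder_def)
  have upper: "minimax \<le> mbar n K \<sigma> y" for y
    using minimax_le_circle_sup circle_sup_le_mbar[OF \<sigma>] by (rule order_trans)
  have lower: "munder n K \<sigma> x \<le> minimax" if "x \<in> Ssimplex n \<sigma>" for x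
    using \<sigma> simplex w(2) that by (rule munder_le_minimax)
  have "(INF y\<in>Ssimplex n \<sigma>. mbar n K \<sigma> y) = minimax"
    using attained(1) upper by (intro antisym INF_lower2[OF simplex] INF_greatest) auto
  moreover have "(SUP y\<in>Ssimplex n \<sigma>. munder n K \<sigma> y) = minimax"
    using attained(2) lower by (intro antisym SUP_upper2[OF simplex] SUP_least) auto
  moreover have "equioscillation n K \<sigma> w" using mloc by (simp add: equioscillation_def)
  ultimately show ?thesis
    unfolding circle_sup_def[symmetric] minimax_def[symmetric]
    using w \<sigma> simplex upper lower by (intro bexI[of _ w] exI[of _ \<sigma>] conjI ballI) simp_all
qed

end
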